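(* Let $x^*$ be a locally optimal solution of the SDCMPCC $\min_{x\in\mathbb{X}}\{\varphi(x)\ \text{s.t.}\ \Upsilon(x)\in K\times\Omega\}$. Suppose that the multifunction $\mathcal{F}(z):=\Upsilon(z)-K\times\Omega$ is metrically subregular at $x^*$ for the origin. Then $\mathcal{M}(x^* )\neq\emptyset$. Moreover, for any $d\in\mathcal{C}(x^* )$ and any nonempty convex set $T(d)\subseteq\mathcal{T}^2_{K\times\Omega}(\Upsilon(x^* );\Upsilon'(x^* )d)$ such that \[ \mathrm{ri}\big[T(d)+\mathcal{T}^c_{K\times\Omega}(\Upsilon(x^* ))\big]\cap\big[\mathrm{range}(\Upsilon'(x^* ))+\nabla^2\Upsilon(x^* )(d,d)\big]\neq\emptyset, \] it holds that \[ \sup_{(\xi,\Gamma)\in\mathcal{M}^c(x^* )}\Big\{\langle d,\nabla^2_{xx}L(x^*,\xi,\Gamma)d\rangle-\sigma\big((\xi,\Gamma)\mid T(d)\big)\Big\}\ge0. \]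
   Context: Standing setting: $\mathbb{X},\mathbb{Y}$ are finite-dimensional real inner product spaces; $\mathbb{S}^n$ is the space of real symmetric $n\times n$ matrices with the trace inner product; $\mathbb{S}^n_\pm$ the positive/negative semidefinite cones. $\varphi:\mathbb{X}\to\mathbb{R}$, $h:\mathbb{X}\to\mathbb{Y}$, $\theta,\zeta:\mathbb{X}\to\mathbb{S}^n$ are twice differentiable; $K\subseteq\mathbb{Y}$ is a closed convex cone which is second-order regular (at every point in every tangent direction). $\Omega:=\{(X,Y)\mid X\in\mathbb{S}^n_+,\ Y\in\mathbb{S}^n_-,\ \langle X,Y\rangle=0\}$, $\Theta(x):=(\theta(x),\zeta(x))$, $\Upsilon(x):=(h(x),\Theta(x))$; the feasible set is $\mathcal{S}=\{x\mid\Upsilon(x)\in K\times\Omega\}$. For a closed set $C$ and $y\in C$: Bouligand tangent cone $\mathcal{T}_C(y)=\{v\mid\exists t_k\downarrow0,v^k\to v,\ y+t_kv^k\in C\}$; Clarke tangent cone $\mathcal{T}^c_C(y)=\{v\mid \forall t_k\downarrow0,\ \forall y^k\to y \text{ in } C,\ \exists v^k\to v,\ y^k+t_kv^k\in C\}$; regular normal cone $\widehat{\mathcal{N}}_C(y)=[\mathcal{T}_C(y)]^\circ$ (negative polar); limiting normal cone $\mathcal{N}_C(y)=\{v\mid\exists y^k\to y \text{ in } C,\ v^k\to v,\ v^k\in\widehat{\mathcal{N}}_C(y^k)\}$; Clarke normal cone $\mathcal{N}^c_C(y)=\mathrm{cl\,co}\,\mathcal{N}_C(y)$; outer second-order tangent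 set $\mathcal{T}^2_C(y;v)=\{w\mid\exists t_k\downarrow0,\ \mathrm{dist}(y+t_kv+\tfrac12t_k^2w,C)=o(t_k^2)\}$. $\sigma(\cdot\mid T)$ is the support function of $T$, $\mathrm{ri}$ the relative interior. Critical cone: $\mathcal{C}(x)=\{d\mid\varphi'(x)d\le0,\ \Upsilon'(x)d\in\mathcal{T}_{K\times\Omega}(\Upsilon(x))\}$. Lagrangian: $L(x,\xi,\Gamma)=\varphi(x)+\langle\xi,h(x)\rangle+\langle\Gamma,\Theta(x)\rangle$ for $(\xi,\Gamma)\in\mathbb{Y}\times(\mathbb{S}^n\times\mathbb{S}^n)$. Multiplier sets: $\mathcal{M}^c(x)=\{(\xi,\Gamma)\mid\nabla_xL(x,\xi,\Gamma)=0,\ (\xi,\Gamma)\in\mathcal{N}^c_{K\times\Omega}(\Upsilon(x))\}$, $\mathcal{M}(x)$ and $\widehat{\mathcal{M}}(x)$ defined likewise with $\mathcal{N}_{K\times\Omega}$ and $\widehat{\mathcal{N}}_{K\times\Omega}$ respectively. $\mathcal{F}(z)=\Upsilon(z)-K\times\Omega$ is metrically subregular at $x^*$ for the origin if there are $\kappa,\rho>0$ with $\mathrm{dist}(x,\mathcal{S})\le\kappa\,\mathrm{dist}(\Upsilon(x),K\times\Omega)$ for all $\|x-x^*\|\le\rho$. $\nabla^2\Upsilon(x)(d,d)$ denotes the second derivative of $\Upsilon$ at $x$ evaluated at $(d,d)$. *)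

theory Defs
  imports "HOL-Analysis.Analysis"
begin

text \<open>S^n is represented inside real^'n^'n (whose built-in inner product is the
  Frobenius = trace inner product).\<close>

definition sym_mat :: "real^'n^'n \<Rightarrow> bool" where
  "sym_mat A \<longleftrightarrow> transpose A = A"

definition psd_mat :: "real^'n^'n \<Rightarrow> bool" where
  "psd_mat A \<longleftrightarrow> sym_mat A \<and> (\<forall>v. 0 \<le> v \<bullet> (A *v v))"

definition nsd_mat :: "real^'n^'n \<Rightarrow> bool" where
  "nsd_mat A \<longleftrightarrow> sym_mat A \<and> (\<forall>v. v \<bullet> (A *v v) \<le> 0)"

definition Omega :: "((real^'n^'n) \<times> (real^'n^'n)) set" where
  "Omega = {(X, Y). psd_mat X \<and> nsd_mat Y \<and> trace (transpose X ** Y) = 0}"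

definition bouligand_tangent :: "'a::real_normed_vector set \<Rightarrow> 'a \<Rightarrow> 'a set" where
  "bouligand_tangent C y = {v. \<exists>t w. (\<forall>k. t k > 0) \<and> t \<longlonglongrightarrow> 0 \<and> w \<longlonglongrightarrow> v
      \<and> (\<forall>k. y + t k *\<^sub>R w k \<in> C)}"

definition clarke_tangent :: "'a::real_normed_vector set \<Rightarrow> 'a \<Rightarrow> 'a set" where
  "clarke_tangent C y = {v. \<forall>t yk. (\<forall>k. t k > 0) \<and> t \<longlonglongrightarrow> 0 \<and> (\<forall>k. yk k \<in> C) \<and> yk \<longlonglongrightarrow> y
      \<longrightarrow> (\<exists>w. w \<longlonglongrightarrow> v \<and> (\<forall>k. yk k + t k *\<^sub>R w k \<in> C))}"

definition regular_normal :: "'a::real_inner set \<Rightarrow> 'a \<Rightarrow> 'a set" where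
  "regular_normal C y = {v. \<forall>w \<in> bouligand_tangent C y. v \<bullet> w \<le> 0}"

definition limiting_normal :: "'a::real_inner set \<Rightarrow> 'a \<Rightarrow> 'a set" where
  "limiting_normal C y = {v. \<exists>yk vk. (\<forall>k. yk k \<in> C) \<and> yk \<longlonglongrightarrow> y \<and> vk \<longlonglongrightarrow> v
      \<and> (\<forall>k. vk k \<in> regular_normal C (yk k))}"

definition clarke_normal :: "'a::real_inner set \<Rightarrow> 'a \<Rightarrow> 'a set" where
  "clarke_normal C y = closure (convex hull (limiting_normal C y))"

definition outer_so_tangent :: "'a::real_normed_vector set \<Rightarrow> 'a \<Rightarrow> 'a \<Rightarrow> 'a set" where
  "outer_so_tangent C y v = {w. \<exists>t. (\<forall>k. t k > 0) \<and> t \<longlonglongrightarrow> 0 \<and>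
      (\<lambda>k. infdist (y + t k *\<^sub>R v + ((t k)\<^sup>2 / 2) *\<^sub>R w) C / (t k)\<^sup>2) \<longlonglongrightarrow> 0}"

definition inner_so_tangent :: "'a::real_normed_vector set \<Rightarrow> 'a \<Rightarrow> 'a \<Rightarrow> 'a set" where
  "inner_so_tangent C y v = {w.
      ((\<lambda>t. infdist (y + t *\<^sub>R v + (t\<^sup>2 / 2) *\<^sub>R w) C / t\<^sup>2) \<longlongrightarrow> 0) (at_right 0)}"

text \<open>Outer second-order regularity (Bonnans--Shapiro, Def. 3.85), with the convention
  dist(r, {}) = +infinity (hence the explicit nonemptiness requirement).\<close>
definition outer_so_regular_at :: "'a::real_normed_vector set \<Rightarrow> 'a \<Rightarrow> 'a \<Rightarrow> bool" where
  "outer_so_regular_at C y h \<longleftrightarrow>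
     (\<forall>t r. (\<forall>n. t n > 0) \<and> t \<longlonglongrightarrow> 0 \<and> (\<lambda>n. t n *\<^sub>R r n) \<longlonglongrightarrow> 0
        \<and> (\<forall>n. y + t n *\<^sub>R h + ((t n)\<^sup>2 / 2) *\<^sub>R r n \<in> C)
        \<longrightarrow> outer_so_tangent C y h \<noteq> {} \<and> (\<lambda>n. infdist (r n) (outer_so_tangent C y h)) \<longlonglongrightarrow> 0)"

definition second_order_regular :: "'a::real_normed_vector set \<Rightarrow> bool" where
  "second_order_regular C \<longleftrightarrow> (\<forall>y \<in> C. \<forall>h \<in> bouligand_tangent C y.
      outer_so_regular_at C y h \<and> outer_so_tangent C y h = inner_so_tangent C y h)"

definition support_fun :: "'a::real_inner \<Rightarrow> 'a set \<Rightarrow> ereal" where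
  "support_fun u T = (SUP w \<in> T. ereal (u \<bullet> w))"

definition Ups :: "('x \<Rightarrow> 'y) \<Rightarrow> ('x \<Rightarrow> 'm) \<Rightarrow> ('x \<Rightarrow> 'm) \<Rightarrow> 'x \<Rightarrow> 'y \<times> ('m \<times> 'm)" where
  "Ups h \<theta> \<zeta> x = (h x, (\<theta> x, \<zeta> x))"

definition DUps :: "('x \<Rightarrow> 'x \<Rightarrow> 'y) \<Rightarrow> ('x \<Rightarrow> 'x \<Rightarrow> 'm) \<Rightarrow> ('x \<Rightarrow> 'x \<Rightarrow> 'm) \<Rightarrow> 'x \<Rightarrow> 'x \<Rightarrow> 'y \<times> ('m \<times> 'm)" where
  "DUps h' \<theta>' \<zeta>' x d = (h' x d, (\<theta>' x d, \<zeta>' x d))"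

definition D2Ups :: "('x \<Rightarrow> 'x \<Rightarrow> 'x \<Rightarrow> 'y) \<Rightarrow> ('x \<Rightarrow> 'x \<Rightarrow> 'x \<Rightarrow> 'm) \<Rightarrow> ('x \<Rightarrow> 'x \<Rightarrow> 'x \<Rightarrow> 'm)
    \<Rightarrow> 'x \<Rightarrow> 'x \<Rightarrow> 'x \<Rightarrow> 'y \<times> ('m \<times> 'm)" where
  "D2Ups h'' \<theta>'' \<zeta>'' x u v = (h'' x u v, (\<theta>'' x u v, \<zeta>'' x u v))"

definition feasible_set :: "('x \<Rightarrow> 'y \<times> 'z) \<Rightarrow> ('y \<times> 'z) set \<Rightarrow> 'x set" where
  "feasible_set U C = {x. U x \<in> C}"

definition local_minimizer :: "('x::metric_space \<Rightarrow> real) \<Rightarrow> 'x set \<Rightarrow> 'x \<Rightarrow> bool" where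
  "local_minimizer f S x0 \<longleftrightarrow> x0 \<in> S \<and> (\<exists>e>0. \<forall>x\<in>S. dist x x0 < e \<longrightarrow> f x0 \<le> f x)"

text \<open>Metric subregularity of F(z) = U(z) - C at x0 for the origin.\<close>
definition metrically_subregular :: "('x::real_normed_vector \<Rightarrow> 'w::real_normed_vector) \<Rightarrow> 'w set \<Rightarrow> 'x \<Rightarrow> bool" where
  "metrically_subregular U C x0 \<longleftrightarrow> (\<exists>\<kappa>>0. \<exists>\<rho>>0. \<forall>x. norm (x - x0) \<le> \<rho> \<longrightarrow>
      infdist x {z. U z \<in> C} \<le> \<kappa> * infdist (U x) C)"

definition critical_cone :: "('x \<Rightarrow> 'x \<Rightarrow> real) \<Rightarrow> ('x \<Rightarrow> 'w) \<Rightarrow> ('x \<Rightarrow> 'x \<Rightarrow> 'w::real_normed_vector)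
    \<Rightarrow> 'w set \<Rightarrow> 'x \<Rightarrow> 'x set" where
  "critical_cone \<phi>' U U' C x = {d. \<phi>' x d \<le> 0 \<and> U' x d \<in> bouligand_tangent C (U x)}"

text \<open>Multiplier set w.r.t. a given normal cone operator N:
  nabla_x L(x,xi,Gamma) = 0 (i.e. phi'(x)d + <(xi,Gamma), Ups'(x)d> = 0 for all d),
  (xi,Gamma) in N(K x Omega, Ups x), and Gamma in S^n x S^n.\<close>
type_synonym ('y, 'n) mspace = "'y \<times> ((real^'n^'n) \<times> (real^'n^'n))"

definition multipliers ::
  "(('y, 'n) mspace set \<Rightarrow> ('y, 'n) mspace \<Rightarrow> ('y, 'n) mspace set)
   \<Rightarrow> ('x \<Rightarrow> 'x \<Rightarrow> real) \<Rightarrow> ('x \<Rightarrow> ('y::real_inner, 'n::finite) mspace)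
   \<Rightarrow> ('x \<Rightarrow> 'x \<Rightarrow> ('y, 'n) mspace)
   \<Rightarrow> ('y, 'n) mspace set \<Rightarrow> 'x \<Rightarrow> ('y, 'n) mspace set" where
  "multipliers N \<phi>' U U' C x = {(\<xi>, \<Gamma>).
      (\<forall>d. \<phi>' x d + (\<xi>, \<Gamma>) \<bullet> U' x d = 0)
      \<and> (\<xi>, \<Gamma>) \<in> N C (U x) \<and> sym_mat (fst \<Gamma>) \<and> sym_mat (snd \<Gamma>)}"

end

theory Submission
  imports Defs
begin

text \<open>
  Write \<open>U = \<Upsilon>\<close>, \<open>C = K \<times> \<Omega>\<close>. Subregularity yields the exact penalty
  \<open>\<phi>(x) + M\<bar>U(x) - y\<bar>\<close> over \<open>y \<in> C\<close>; smoothing the norm by \<open>\<surd>(\<bar>\<cdot>\<bar>\<^sup>2 + \<epsilon>\<^sup>2)\<close>,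
  adding \<open>\<bar>x - x\<^sub>0\<bar>\<^sup>2 + \<bar>y - U(x\<^sub>0)\<bar>\<^sup>2\<close> and letting \<open>\<epsilon> \<rightarrow> 0\<close> produces a limiting multiplier.

  For the second-order part, adding a Clarke tangent vector does not leave the outer second-order tangent
  set, and subregularity lifts second-order tangents to parabolic feasible curves. Hence
  \<open>\<phi>'w + \<phi>''(d,d) \<ge> 0\<close> whenever \<open>U'w + U''(d,d)\<close> lies in the convex set \<open>T + T\<^sup>c\<close>. The relative interior
  condition gives an attained dual solution \<open>m\<close>; finiteness of its support function makes it polar to the
  Clarke tangent cone, so it is a Clarke normal. Since \<open>\<real>\<^bsup>n\<times>n\<^esup>\<close> contains more than the symmetric matrices,
  both multipliers are finally projected onto the symmetric ones.
\<close>

section \<open>Expansions along sequences\<close>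

text \<open>The quotient differs from \<open>f' (w k)\<close> by the first-order remainder at
  \<open>t k *\<^sub>R w k\<close> divided by \<open>t k\<close>, which vanishes because a
  convergent \<open>w\<close> is bounded. Letting the direction vary matches the sequences that
  define tangent cones.\<close>

lemma has_derivative_along_sequence:
  fixes f :: "'a::real_normed_vector \<Rightarrow> 'b::real_normed_vector"
  assumes f: "(f has_derivative f') (at x)"
    and t: "\<And>k. t k > 0" "t \<longlonglongrightarrow> 0" and w: "w \<longlonglongrightarrow> v"
  shows "(\<lambda>k. (1 / t k) *\<^sub>R (f (x + t k *\<^sub>R w k) - f x)) \<longlonglongrightarrow> f' v"
proof -
  have lin: "bounded_linear f'"
    and alt: "\<And>e. e > 0 \<Longrightarrow> \<exists>d>0. \<forall>y. norm (y - x) < d \<longrightarrow> norm (f y - f x - f' (y - x)) \<le> e * norm (y - x)"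
    using f unfolding has_derivative_at_alt by auto
  have tw: "(\<lambda>k. t k *\<^sub>R w k) \<longlonglongrightarrow> 0"
    using tendsto_scaleR[OF t(2) w] by simp
  obtain B where B: "B > 0" "\<And>k. norm (w k) \<le> B"
    using Bseq_def convergent_imp_Bseq convergentI[OF w] by blast
  have "(\<lambda>k. (1 / t k) *\<^sub>R (f (x + t k *\<^sub>R w k) - f x) - f' (w k)) \<longlonglongrightarrow> 0"
  proof (rule tendstoI)
    fix e :: real assume e: "e > 0"
    obtain d where d: "d > 0" "\<And>y. norm (y - x) < d \<Longrightarrow> norm (f y - f x - f' (y - x)) \<le> e / (2 * B) * norm (y - x)"
      using alt[of "e / (2 * B)"] e B by auto
    have "eventually (\<lambda>k. norm (t k *\<^sub>R w k) < d) sequentially"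
      using tendstoD[OF tw d(1)] by (simp add: dist_norm)
    then show "eventually (\<lambda>k. dist ((1 / t k) *\<^sub>R (f (x + t k *\<^sub>R w k) - f x) - f' (w k)) 0 < e) sequentially"
    proof eventually_elim
      case (elim k)
      have "(1 / t k) *\<^sub>R (f (x + t k *\<^sub>R w k) - f x) - f' (w k)
          = (1 / t k) *\<^sub>R (f (x + t k *\<^sub>R w k) - f x - f' (t k *\<^sub>R w k))"
        using t(1)[of k] linear_scale[OF bounded_linear.linear[OF lin], of "t k" "w k"]
        by (simp add: algebra_simps)
      then have "norm ((1 / t k) *\<^sub>R (f (x + t k *\<^sub>R w k) - f x) - f' (w k))
          \<le> (1 / t k) * (e / (2 * B) * norm (t k *\<^sub>R w k))"
        using mult_left_mono[OF d(2)[of "x + t k *\<^sub>R w k"], of "1 / t k"] elim t(1)[of k] by simp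
      also have "\<dots> = e / (2 * B) * norm (w k)"
        using t(1)[of k] by simp
      also have "\<dots> \<le> e / (2 * B) * B"
        using B e by (intro mult_left_mono) auto
      also have "\<dots> < e" using B e by simp
      finally show ?case by simp
    qed
  qed
  from tendsto_add[OF this bounded_linear.tendsto[OF lin w]] show ?thesis by simp
qed

text \<open>Differentiability is given for each fixed direction \<open>u\<close> separately. The
  remainder is linear in \<open>u\<close>, so estimates for the finitely many basis vectors combine
  into one that is uniform in \<open>u\<close>.\<close>

lemma has_derivative_uniform_in_direction:
  fixes F :: "'a::euclidean_space \<Rightarrow> 'b::euclidean_space \<Rightarrow> 'c::real_normed_vector"
  assumes lin: "\<And>y. linear (F y)" and linB: "\<And>v. linear (\<lambda>u. B u v)"
    and d: "\<And>u. ((\<lambda>y. F y u) has_derivative B u) (at x)" and e: "e > 0"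
  shows "\<exists>\<delta>>0. \<forall>v u. norm v < \<delta> \<longrightarrow> norm (F (x + v) u - F x u - B u v) \<le> e * norm v * norm u"
proof -
  \<comment> \<open>Each coordinate of \<open>u\<close> is at most \<open>norm u\<close>, so the
    basis expansion adds up \<open>DIM('b)\<close> equal error bounds.\<close>
  define e' where "e' = e / real DIM('b)"
  have e': "e' > 0" using e by (simp add: e'_def)
  have "\<exists>\<delta>>0. \<forall>v. norm v < \<delta> \<longrightarrow> norm (F (x + v) i - F x i - B i v) \<le> e' * norm v" for i
  proof -
    obtain \<delta> where "\<delta> > 0" "\<forall>y. norm (y - x) < \<delta> \<longrightarrow> norm (F y i - F x i - B i (y - x)) \<le> e' * norm (y - x)"
      using d[of i] e' unfolding has_derivative_at_alt by blast
    then show ?thesis by (metis add_diff_cancel_left')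
  qed
  then obtain \<delta> where \<delta>: "\<And>i. \<delta> i > 0"
    "\<And>i v. norm v < \<delta> i \<Longrightarrow> norm (F (x + v) i - F x i - B i v) \<le> e' * norm v" by metis
  have "norm (F (x + v) u - F x u - B u v) \<le> e * norm v * norm u" if v: "norm v < Min (\<delta> ` Basis)" for v u
  proof -
    define G where "G u = F (x + v) u - F x u - B u v" for u
    have linG: "linear G"
      unfolding G_def by (intro linear_compose_sub lin linB)
    have "G u = (\<Sum>i\<in>Basis. (u \<bullet> i) *\<^sub>R G i)"
      using linear_sum[OF linG] linear_scale[OF linG] by (metis (no_types, lifting) euclidean_representation sum.cong)
    then have "norm (G u) \<le> (\<Sum>i\<in>Basis. norm ((u \<bullet> i) *\<^sub>R G i))"
      using norm_sum by metis
    also have "\<dots> \<le> (\<Sum>i\<in>(Basis::'b set). norm u * (e' * norm v))"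
    proof (rule sum_mono)
      fix i :: 'b assume i: "i \<in> Basis"
      have "norm (G i) \<le> e' * norm v" unfolding G_def using v i by (intro \<delta>(2)) auto
      then show "norm ((u \<bullet> i) *\<^sub>R G i) \<le> norm u * (e' * norm v)"
        using Basis_le_norm[OF i, of u] by (auto intro!: mult_mono)
    qed
    also have "\<dots> = e * norm v * norm u" by (simp add: e'_def)
    finally show ?thesis by (simp add: G_def)
  qed
  moreover have "Min (\<delta> ` Basis) > 0" using \<delta>(1) by (subst Min_gr_iff) auto
  ultimately show ?thesis by blast
qed

text \<open>Linearity in the first direction is inherited from \<open>f' y\<close>: differentiating
  the identity in \<open>y\<close> gives two derivatives of one function, and derivatives are
  unique.\<close>

lemma linear_second_derivative:
  assumes df: "\<And>x. (f has_derivative f' x) (at x)"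
    and d2f: "\<And>x u. ((\<lambda>y. f' y u) has_derivative f'' x u) (at x)"
  shows "linear (\<lambda>u. f'' x u v)"
proof
  have lin: "linear (f' y)" for y using df has_derivative_linear by blast
  show "f'' x (a + b) v = f'' x a v + f'' x b v" for a b
  proof -
    have "((\<lambda>y. f' y (a + b)) has_derivative (\<lambda>v. f'' x a v + f'' x b v)) (at x)"
      unfolding linear_add[OF lin] by (intro has_derivative_add d2f)
    then show ?thesis using has_derivative_unique[OF d2f] by metis
  qed
  show "f'' x (r *\<^sub>R a) v = r *\<^sub>R f'' x a v" for r a
  proof -
    have "((\<lambda>y. f' y (r *\<^sub>R a)) has_derivative (\<lambda>v. r *\<^sub>R f'' x a v)) (at x)"
      unfolding linear_scale[OF lin] by (intro has_derivative_scaleR_right d2f)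
    then show ?thesis using has_derivative_unique[OF d2f] by metis
  qed
qed

text \<open>The mean value theorem is applied on the ray \<open>s \<mapsto> x + s v\<close> only, since \<open>f''\<close> is not known to be
  symmetric.\<close>
lemma second_order_taylor:
  fixes f :: "'a::euclidean_space \<Rightarrow> 'b::euclidean_space"
  assumes df: "\<And>x. (f has_derivative f' x) (at x)"
    and d2f: "\<And>x u. ((\<lambda>y. f' y u) has_derivative f'' x u) (at x)" and e: "e > 0"
  shows "\<exists>\<delta>>0. \<forall>v. norm v < \<delta> \<longrightarrow>
    norm (f (x + v) - f x - f' x v - (1 / 2) *\<^sub>R f'' x v v) \<le> e * (norm v)\<^sup>2"
proof -
  have lin: "linear (f' y)" for y using df has_derivative_linear by blast
  have lin1: "linear (f'' x u)" for u using d2f has_derivative_linear by blast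
  obtain \<delta> where \<delta>: "\<delta> > 0"
    "\<And>v u. norm v < \<delta> \<Longrightarrow> norm (f' (x + v) u - f' x u - f'' x u v) \<le> e * norm v * norm u"
    using has_derivative_uniform_in_direction[OF lin linear_second_derivative[OF df d2f] d2f e] by meson
  have "norm (f (x + v) - f x - f' x v - (1 / 2) *\<^sub>R f'' x v v) \<le> e * (norm v)\<^sup>2" if v: "norm v < \<delta>" for v
  proof -
    \<comment> \<open>\<open>g 1 - g 0\<close> is exactly the Taylor remainder, and the derivative
      of \<open>g\<close> is the first-order remainder of \<open>f'\<close> evaluated in the
      direction \<open>v\<close>.\<close>
    define g where "g s = f (x + s *\<^sub>R v) - s *\<^sub>R f' x v - (s\<^sup>2 / 2) *\<^sub>R f'' x v v" for s
    define g' where "g' s = (\<lambda>h. h *\<^sub>R (f' (x + s *\<^sub>R v) v - f' x v - s *\<^sub>R f'' x v v))" for s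
    have "(g has_derivative g' s) (at s within {0..1})" for s
    proof -
      have 1: "((\<lambda>s. f (x + s *\<^sub>R v)) has_derivative (\<lambda>h. f' (x + s *\<^sub>R v) (h *\<^sub>R v))) (at s within {0..1})"
        by (rule has_derivative_compose[OF _ df]) (auto intro!: derivative_eq_intros)
      have 2: "((\<lambda>s. (s\<^sup>2 / 2)) has_derivative (\<lambda>h. s * h)) (at s within {0..1})"
        by (auto intro!: derivative_eq_intros)
      show ?thesis
        unfolding g_def
        apply (rule has_derivative_eq_rhs)
         apply (rule derivative_intros 1 2 has_derivative_scaleR_left)+
        by (auto simp: g'_def linear_scale[OF lin] algebra_simps fun_eq_iff)
    qed
    moreover have "onorm (g' s) \<le> e * (norm v)\<^sup>2" if s: "s \<in> {0..1}" for s
    proof (rule onorm_le)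
      fix h
      have sv: "norm (s *\<^sub>R v) \<le> norm v" using s mult_right_mono[of s 1 "norm v"] by simp
      have "norm (f' (x + s *\<^sub>R v) v - f' x v - s *\<^sub>R f'' x v v) \<le> e * norm (s *\<^sub>R v) * norm v"
        using \<delta>(2)[of "s *\<^sub>R v" v] v sv linear_scale[OF lin1, of v s v] by simp
      also have "\<dots> \<le> e * (norm v)\<^sup>2"
        unfolding power2_eq_square mult.assoc using sv e by (intro mult_left_mono mult_right_mono) auto
      finally show "norm (g' s h) \<le> e * (norm v)\<^sup>2 * norm h"
        unfolding g'_def by (simp add: mult.commute mult_left_mono)
    qed
    ultimately have "norm (g 1 - g 0) \<le> e * (norm v)\<^sup>2 * norm (1 - 0 :: real)"
      by (intro differentiable_bound[of "{0..1}"]) auto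
    then show ?thesis by (simp add: g_def algebra_simps)
  qed
  then show ?thesis using \<delta>(1) by blast
qed

lemma second_order_expansion_along_sequence:
  fixes f :: "'a::euclidean_space \<Rightarrow> 'b::euclidean_space"
  assumes df: "\<And>x. (f has_derivative f' x) (at x)"
    and d2f: "\<And>x u. ((\<lambda>y. f' y u) has_derivative f'' x u) (at x)"
    and t: "\<And>k. t k > 0" "t \<longlonglongrightarrow> 0" and w: "w \<longlonglongrightarrow> v"
  shows "(\<lambda>k. (2 / (t k)\<^sup>2) *\<^sub>R (f (x + t k *\<^sub>R d + ((t k)\<^sup>2 / 2) *\<^sub>R w k) - f x - t k *\<^sub>R f' x d))
    \<longlonglongrightarrow> f' x v + f'' x d d"
proof -
  have lin: "linear (f' y)" for y using df has_derivative_linear by blast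
  have lin1: "linear (f'' x u)" for u using d2f has_derivative_linear by blast
  have lin2: "linear (\<lambda>u. f'' x u v)" for v by (rule linear_second_derivative[OF df d2f])
  have bl: "bounded_bilinear (f'' x)"
    using lin1 lin2 by (simp add: bilinear_conv_bounded_bilinear[symmetric] bilinear_def)
  \<comment> \<open>The parabolic arc is rewritten as \<open>x + t k *\<^sub>R D k\<close> with
    \<open>D\<close> tending to \<open>d\<close>, so that Taylor's formula at the increment
    \<open>t k *\<^sub>R D k\<close> applies. Its linear part produces \<open>f' x (w k)\<close> and
    its quadratic part \<open>f'' x (D k) (D k)\<close>.\<close>
  define D where "D k = d + (t k / 2) *\<^sub>R w k" for k
  have "D \<longlonglongrightarrow> d + (0 / 2) *\<^sub>R v"
    unfolding D_def by (intro tendsto_intros t w) auto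
  then have D: "D \<longlonglongrightarrow> d" by simp
  have tD: "(\<lambda>k. t k *\<^sub>R D k) \<longlonglongrightarrow> 0"
    using tendsto_scaleR[OF t(2) D] by simp
  obtain B where B: "B > 0" "\<And>k. norm (D k) \<le> B"
    using Bseq_def convergent_imp_Bseq convergentI[OF D] by blast
  define R where "R v = f (x + v) - f x - f' x v - (1 / 2) *\<^sub>R f'' x v v" for v
  have R: "(\<lambda>k. (2 / (t k)\<^sup>2) *\<^sub>R R (t k *\<^sub>R D k)) \<longlonglongrightarrow> 0"
  proof (rule tendstoI)
    fix e :: real assume e: "e > 0"
    have "e / (4 * B\<^sup>2) > 0" using e B by simp
    from second_order_taylor[OF df d2f this, of x]
    obtain \<delta> where \<delta>: "\<delta> > 0" "\<And>v. norm v < \<delta> \<Longrightarrow> norm (R v) \<le> e / (4 * B\<^sup>2) * (norm v)\<^sup>2"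
      unfolding R_def by blast
    have "eventually (\<lambda>k. norm (t k *\<^sub>R D k) < \<delta>) sequentially"
      using tendstoD[OF tD \<delta>(1)] by (simp add: dist_norm)
    then show "eventually (\<lambda>k. dist ((2 / (t k)\<^sup>2) *\<^sub>R R (t k *\<^sub>R D k)) 0 < e) sequentially"
    proof eventually_elim
      case (elim k)
      have "norm ((2 / (t k)\<^sup>2) *\<^sub>R R (t k *\<^sub>R D k)) \<le> (2 / (t k)\<^sup>2) * (e / (4 * B\<^sup>2) * (norm (t k *\<^sub>R D k))\<^sup>2)"
        using mult_left_mono[OF \<delta>(2)[OF elim], of "2 / (t k)\<^sup>2"] t(1)[of k] by simp
      also have "\<dots> = e / (2 * B\<^sup>2) * (norm (D k))\<^sup>2"
        using t(1)[of k] by (simp add: power_mult_distrib)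
      also have "\<dots> \<le> e / (2 * B\<^sup>2) * B\<^sup>2"
        using B e by (intro mult_left_mono power_mono) auto
      also have "\<dots> < e" using B e by simp
      finally show ?case by simp
    qed
  qed
  have "(\<lambda>k. (2 / (t k)\<^sup>2) *\<^sub>R R (t k *\<^sub>R D k) + (f' x (w k) + f'' x (D k) (D k))) \<longlonglongrightarrow> 0 + (f' x v + f'' x d d)"
    by (intro tendsto_add R bounded_bilinear.tendsto[OF bl] D
        bounded_linear.tendsto[OF has_derivative_bounded_linear[OF df] w])
  moreover have "(2 / (t k)\<^sup>2) *\<^sub>R R (t k *\<^sub>R D k) + (f' x (w k) + f'' x (D k) (D k))
     = (2 / (t k)\<^sup>2) *\<^sub>R (f (x + t k *\<^sub>R d + ((t k)\<^sup>2 / 2) *\<^sub>R w k) - f x - t k *\<^sub>R f' x d)" for k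
  proof -
    have [simp]: "t k \<noteq> 0" using t(1)[of k] by simp
    have tDk: "t k *\<^sub>R D k = t k *\<^sub>R d + ((t k)\<^sup>2 / 2) *\<^sub>R w k"
      by (simp add: D_def algebra_simps power2_eq_square)
    have q: "f'' x (t k *\<^sub>R D k) (t k *\<^sub>R D k) = (t k)\<^sup>2 *\<^sub>R f'' x (D k) (D k)"
      using linear_scale[OF lin1] linear_scale[OF lin2] by (simp add: power2_eq_square)
    have l: "f' x (t k *\<^sub>R D k) = t k *\<^sub>R f' x d + ((t k)\<^sup>2 / 2) *\<^sub>R f' x (w k)"
      unfolding tDk by (simp add: linear_add[OF lin] linear_scale[OF lin])
    have a: "x + t k *\<^sub>R D k = x + t k *\<^sub>R d + ((t k)\<^sup>2 / 2) *\<^sub>R w k"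
      unfolding tDk by (simp add: add.assoc)
    show ?thesis
      unfolding R_def q l a by (simp add: scaleR_diff_right scaleR_add_right)
  qed
  ultimately show ?thesis by simp
qed

section \<open>Tangent and normal cones\<close>

lemma regular_normal_cone: "v \<in> regular_normal C y \<Longrightarrow> c \<ge> 0 \<Longrightarrow> c *\<^sub>R v \<in> regular_normal C y"
  by (auto simp: regular_normal_def mult_nonneg_nonpos)

lemma limiting_normal_cone:
  assumes "v \<in> limiting_normal C y" "c \<ge> 0" shows "c *\<^sub>R v \<in> limiting_normal C y"
proof -
  obtain yk vk where "\<And>k. yk k \<in> C" "yk \<longlonglongrightarrow> y" "vk \<longlonglongrightarrow> v" "\<And>k. vk k \<in> regular_normal C (yk k)"
    using assms(1) unfolding limiting_normal_def by blast
  then show ?thesis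
    unfolding limiting_normal_def using assms(2)
    by (intro CollectI exI[of _ yk] exI[of _ "\<lambda>k. c *\<^sub>R vk k"]) (auto intro!: tendsto_intros regular_normal_cone)
qed

lemma zero_in_limiting_normal: "y \<in> C \<Longrightarrow> 0 \<in> limiting_normal C y"
  unfolding limiting_normal_def
  by (intro CollectI exI[of _ "\<lambda>_. y"] exI[of _ "\<lambda>_. 0"]) (auto simp: regular_normal_def)

text \<open>Moving along \<open>u\<close> gives new base points that lie in \<open>C\<close> and
  still converge to \<open>y\<close>. The definition for \<open>v\<close> tolerates varying base
  points, so it can be applied to them.\<close>

lemma clarke_tangent_add:
  assumes "u \<in> clarke_tangent C y" "v \<in> clarke_tangent C y" shows "u + v \<in> clarke_tangent C y"
  unfolding clarke_tangent_def
proof (intro CollectI allI impI, elim conjE)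
  fix t yk assume *: "\<forall>k. t k > 0" "t \<longlonglongrightarrow> (0::real)" "\<forall>k. yk k \<in> C" "yk \<longlonglongrightarrow> y"
  then obtain w where w: "w \<longlonglongrightarrow> u" "\<And>k. yk k + t k *\<^sub>R w k \<in> C"
    using assms(1)[unfolded clarke_tangent_def, THEN CollectD, rule_format, of t yk] by auto
  have "(\<lambda>k. yk k + t k *\<^sub>R w k) \<longlonglongrightarrow> y + 0 *\<^sub>R u"
    by (intro tendsto_intros * w)
  then have "\<exists>z. z \<longlonglongrightarrow> v \<and> (\<forall>k. (yk k + t k *\<^sub>R w k) + t k *\<^sub>R z k \<in> C)"
    using assms(2)[unfolded clarke_tangent_def, THEN CollectD, rule_format, of t "\<lambda>k. yk k + t k *\<^sub>R w k"] * w(2)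
    by simp
  then obtain z where z: "z \<longlonglongrightarrow> v" "\<And>k. (yk k + t k *\<^sub>R w k) + t k *\<^sub>R z k \<in> C"
    by auto
  then show "\<exists>w. w \<longlonglongrightarrow> u + v \<and> (\<forall>k. yk k + t k *\<^sub>R w k \<in> C)"
    using w by (intro exI[of _ "\<lambda>k. w k + z k"]) (auto intro!: tendsto_intros simp: scaleR_add_right add.assoc)
qed

lemma clarke_tangent_scaleR:
  assumes "v \<in> clarke_tangent C y" "c > 0" shows "c *\<^sub>R v \<in> clarke_tangent C y"
  unfolding clarke_tangent_def
proof (intro CollectI allI impI, elim conjE)
  fix t yk assume *: "\<forall>k. t k > 0" "t \<longlonglongrightarrow> (0::real)" "\<forall>k. yk k \<in> C" "yk \<longlonglongrightarrow> y"
  have "(\<lambda>k. c * t k) \<longlonglongrightarrow> 0" "\<forall>k. c * t k > 0"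
    using tendsto_mult_left[OF *(2), of c] * assms(2) by auto
  then obtain w where "w \<longlonglongrightarrow> v" "\<And>k. yk k + (c * t k) *\<^sub>R w k \<in> C"
    using assms(1)[unfolded clarke_tangent_def, THEN CollectD, rule_format, of "\<lambda>k. c * t k" yk] *(3,4) by auto
  then show "\<exists>w. w \<longlonglongrightarrow> c *\<^sub>R v \<and> (\<forall>k. yk k + t k *\<^sub>R w k \<in> C)"
    by (intro exI[of _ "\<lambda>k. c *\<^sub>R w k"]) (auto intro!: tendsto_intros simp: mult.commute)
qed

lemma zero_in_clarke_tangent: "0 \<in> clarke_tangent C y"
  unfolding clarke_tangent_def
  by (auto intro!: exI[of _ "\<lambda>_. 0"])

lemma convex_clarke_tangent: "convex (clarke_tangent C y)"
proof (rule convexI)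
  fix u v :: 'a and a b :: real
  assume "u \<in> clarke_tangent C y" "v \<in> clarke_tangent C y" "0 \<le> a" "0 \<le> b" "a + b = 1"
  then show "a *\<^sub>R u + b *\<^sub>R v \<in> clarke_tangent C y"
    \<comment> \<open>Scaling is available for strictly positive factors only, hence the case
      split.\<close>
    by (cases "a = 0 \<or> b = 0") (auto simp: clarke_tangent_add clarke_tangent_scaleR)
qed

section \<open>Polarity between limiting normals and Clarke tangents\<close>

lemma clarke_tangentI:
  fixes C :: "'a::euclidean_space set"
  assumes C: "closed C" 
    and v: "\<And>e. e > 0 \<Longrightarrow> \<exists>\<delta>>0. \<forall>z t. z \<in> C \<longrightarrow> norm (z - y) < \<delta> \<longrightarrow> 0 < t \<longrightarrow> t < \<delta> \<longrightarrow> infdist (z + t *\<^sub>R v) C \<le> e * t"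
  shows "v \<in> clarke_tangent C y"
  unfolding clarke_tangent_def
proof (intro CollectI allI impI, elim conjE)
  fix t yk assume *: "\<forall>k. t k > 0" "t \<longlonglongrightarrow> (0::real)" "\<forall>k. yk k \<in> C" "yk \<longlonglongrightarrow> y"
  have "\<exists>p\<in>C. infdist (yk k + t k *\<^sub>R v) C = dist (yk k + t k *\<^sub>R v) p" for k
    using infdist_attains_inf[OF C] *(3) by (metis empty_iff)
  then obtain p where p: "\<And>k. p k \<in> C" "\<And>k. infdist (yk k + t k *\<^sub>R v) C = dist (yk k + t k *\<^sub>R v) (p k)" by metis
  \<comment> \<open>The direction is corrected so that the step ends at a nearest point of
    \<open>C\<close>; the correction has norm
    \<open>infdist (yk k + t k *\<^sub>R v) C / t k\<close>.\<close>
  define w where "w k = (1 / t k) *\<^sub>R (p k - yk k)" for k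
  have tk: "t k \<noteq> 0" for k using *(1) by (metis less_irrefl)
  have yw: "yk k + t k *\<^sub>R w k = p k" for k using tk by (simp add: w_def)
  have "w \<longlonglongrightarrow> v"
  proof (rule tendstoI)
    fix e :: real assume e: "e > 0"
    obtain \<delta> where \<delta>: "\<delta> > 0" "\<And>z t. z \<in> C \<Longrightarrow> norm (z - y) < \<delta> \<Longrightarrow> 0 < t \<Longrightarrow> t < \<delta> \<Longrightarrow> infdist (z + t *\<^sub>R v) C \<le> e / 2 * t"
      using v[of "e / 2"] e by auto
    have "eventually (\<lambda>k. t k < \<delta>) sequentially" "eventually (\<lambda>k. dist (yk k) y < \<delta>) sequentially"
      using order_tendstoD(2)[OF *(2)] tendstoD[OF *(4)] \<delta>(1) by auto
    then show "eventually (\<lambda>k. dist (w k) v < e) sequentially"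
    proof eventually_elim
      case (elim k)
      have "dist (w k) v * t k = norm (t k *\<^sub>R (w k - v))"
        using *(1) by (simp add: dist_norm mult.commute less_imp_le)
      also have "\<dots> = dist (yk k + t k *\<^sub>R v) (p k)"
        unfolding dist_norm yw[symmetric] by (subst norm_minus_commute) (simp add: scaleR_diff_right algebra_simps)
      also have "\<dots> \<le> e / 2 * t k"
        using \<delta>(2)[of "yk k" "t k"] * elim p(2) by (simp add: dist_norm)
      finally have "dist (w k) v \<le> e / 2" using *(1) mult_le_cancel_right_pos by blast
      then show ?case using e by simp
    qed
  qed
  then show "\<exists>w. w \<longlonglongrightarrow> v \<and> (\<forall>k. yk k + t k *\<^sub>R w k \<in> C)" using yw p(1) by metis
qed

text \<open>Compactness of the unit sphere: violating normals at points tending to \<open>y\<close>,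
  once normalised, have a cluster point. It is a limiting normal at \<open>y\<close> whose inner
  product with \<open>v\<close> is at least \<open>e\<close>, a contradiction.\<close>

lemma regular_normal_inner_le_near:
  fixes C :: "'a::euclidean_space set"
  assumes v: "\<And>n. n \<in> limiting_normal C y \<Longrightarrow> n \<bullet> v \<le> 0" and e: "e > 0"
  shows "\<exists>\<delta>>0. \<forall>z n. z \<in> C \<longrightarrow> norm (z - y) < \<delta> \<longrightarrow> n \<in> regular_normal C z \<longrightarrow> n \<bullet> v \<le> e * norm n"
proof (rule ccontr)
  assume neg: "\<not> ?thesis"
  have "\<exists>z n. z \<in> C \<and> norm (z - y) < inverse (Suc k) \<and> n \<in> regular_normal C z \<and> e * norm n < n \<bullet> v" for k :: nat
    using neg by (metis inverse_positive_iff_positive not_le of_nat_0_less_iff zero_less_Suc)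
  then obtain z n where zn: "\<And>k. z k \<in> C" "\<And>k. norm (z k - y) < inverse (Suc k)"
    "\<And>k. n k \<in> regular_normal C (z k)" "\<And>k. e * norm (n k) < n k \<bullet> v" by metis
  have n0: "n k \<noteq> 0" for k using zn(4)[of k] by auto
  define m where "m k = (1 / norm (n k)) *\<^sub>R n k" for k
  have m: "m k \<in> regular_normal C (z k)" "norm (m k) = 1" "e \<le> m k \<bullet> v" for k
    using regular_normal_cone[OF zn(3)] n0[of k] zn(4)[of k]
    by (auto simp: m_def divide_simps)
  have "seq_compact (sphere (0::'a) 1)" using compact_sphere compact_eq_seq_compact_metric by blast
  then obtain l r where l: "strict_mono r" "(m \<circ> r) \<longlonglongrightarrow> l"
    using m(2) by (metis mem_sphere_0 seq_compactE)
  have "z \<longlonglongrightarrow> y"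
  proof (rule LIM_zero_cancel, rule tendsto_norm_zero_cancel)
    show "(\<lambda>k. norm (z k - y)) \<longlonglongrightarrow> 0"
      using zn(2) by (intro tendsto_sandwich[OF _ _ tendsto_const LIMSEQ_inverse_real_of_nat])
        (auto intro!: always_eventually less_imp_le)
  qed
  then have "(z \<circ> r) \<longlonglongrightarrow> y" using LIMSEQ_subseq_LIMSEQ l(1) by blast
  then have "l \<in> limiting_normal C y"
    unfolding limiting_normal_def using l m zn by (intro CollectI exI[of _ "z \<circ> r"] exI[of _ "m \<circ> r"]) auto
  then have "l \<bullet> v \<le> 0" by (rule v)
  moreover have "e \<le> l \<bullet> v"
    by (rule LIMSEQ_le_const[OF tendsto_inner[OF l(2) tendsto_const]]) (auto simp: m)
  ultimately show False using e by simp
qed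

text \<open>Fermat's rule over a set: along a tangent sequence the difference quotients of \<psi>
  are eventually nonnegative and tend to \<open>q \<bullet> v\<close>.\<close>

lemma regular_normal_of_local_min:
  fixes \<psi> :: "'a::real_inner \<Rightarrow> real"
  assumes d: "(\<psi> has_derivative (\<lambda>z. q \<bullet> z)) (at y)"
    and e: "e > 0" "\<And>z. z \<in> C \<Longrightarrow> norm (z - y) < e \<Longrightarrow> \<psi> y \<le> \<psi> z"
  shows "- q \<in> regular_normal C y"
  unfolding regular_normal_def
proof (intro CollectI ballI)
  fix v assume "v \<in> bouligand_tangent C y"
  then obtain t w where tw: "\<And>k. t k > 0" "t \<longlonglongrightarrow> 0" "w \<longlonglongrightarrow> v" "\<And>k. y + t k *\<^sub>R w k \<in> C"
    unfolding bouligand_tangent_def by blast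
  have "(\<lambda>k. t k *\<^sub>R w k) \<longlonglongrightarrow> 0" using tendsto_scaleR[OF tw(2,3)] by simp
  from tendstoD[OF this e(1)] have "eventually (\<lambda>k. 0 \<le> (1 / t k) *\<^sub>R (\<psi> (y + t k *\<^sub>R w k) - \<psi> y)) sequentially"
  proof eventually_elim
    case (elim k)
    show ?case using e(2)[OF tw(4)] elim tw(1)[of k] by (simp add: dist_norm)
  qed
  then have "0 \<le> q \<bullet> v"
    by (rule tendsto_lowerbound[OF has_derivative_along_sequence[OF d tw(1-3)]]) auto
  then show "- q \<bullet> v \<le> 0" by simp
qed

text \<open>A nearest point minimises the squared distance to \<open>z\<close> over
  \<open>C\<close>, and the gradient of that function at \<open>p\<close> is
  \<open>- (2 *\<^sub>R (z - p))\<close>.\<close>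

lemma residual_in_regular_normal:
  fixes C :: "'a::real_inner set"
  assumes "infdist z C = dist z p" "C \<noteq> {}"
  shows "z - p \<in> regular_normal C p"
proof -
  have "((\<lambda>y. (z - y) \<bullet> (z - y)) has_derivative (\<lambda>h. (- (2 *\<^sub>R (z - p))) \<bullet> h)) (at p)"
    by (auto intro!: derivative_eq_intros simp: inner_commute fun_eq_iff inner_diff_left inner_diff_right)
  moreover have "(z - p) \<bullet> (z - p) \<le> (z - y) \<bullet> (z - y)" if "y \<in> C" for y
    using infdist_le[OF that, of z] assms(1) unfolding dot_square_norm dist_norm by (intro power_mono) auto
  ultimately have "2 *\<^sub>R (z - p) \<in> regular_normal C p"
    \<comment> \<open>The minimum is global on \<open>C\<close>, so the radius 1 is
      arbitrary.\<close>
    using regular_normal_of_local_min[of _ "- (2 *\<^sub>R (z - p))" p 1 C] by simp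
  from regular_normal_cone[OF this, of "1/2"] show ?thesis by simp
qed

text \<open>The squared distance along \<open>z + s v\<close> is followed in \<open>N\<close> Euler steps; each one is controlled by the
  normal \<open>x - p\<close> at a projection \<open>p\<close>, and the quadratic error vanishes as \<open>N \<rightarrow> \<infinity>\<close>.\<close>
lemma infdist_growth:
  fixes C :: "'a::euclidean_space set"
  assumes C: "closed C" and z: "z \<in> C" 
    and e: "\<And>p n. p \<in> C \<Longrightarrow> norm (p - z) \<le> 2 * t * norm v \<Longrightarrow> n \<in> regular_normal C p \<Longrightarrow> n \<bullet> v \<le> e * norm n"
    and t: "t > 0" and e0: "e \<ge> 0"
  shows "(infdist (z + t *\<^sub>R v) C)\<^sup>2 \<le> 2 * e * norm v * t\<^sup>2"
proof -
  have bd: "(infdist (z + t *\<^sub>R v) C)\<^sup>2 \<le> 2 * e * norm v * t\<^sup>2 + (norm v)\<^sup>2 * t\<^sup>2 * inverse (real (Suc M))" for M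
  proof -
    define N where "N = Suc M"
    have N: "real N > 0" by (simp add: N_def)
    define s where "s = t / N"
    have s: "s > 0" using t N by (simp add: s_def)
    define g where "g k = (infdist (z + (k * s) *\<^sub>R v) C)\<^sup>2" for k :: nat
    have step: "g k \<le> k * (2 * s * e * t * norm v + s\<^sup>2 * (norm v)\<^sup>2)" if "k \<le> N" for k
      using that
    proof (induction k)
      case 0
      show ?case using z by (simp add: g_def)
    next
      case (Suc k)
      define x where "x = z + (k * s) *\<^sub>R v"
      obtain p where p: "p \<in> C" "infdist x C = dist x p"
        using infdist_attains_inf[OF C] z by (metis empty_iff)
      have "k * s \<le> N * s" using Suc.prems s by (intro mult_right_mono) auto
      also have "N * s = t" using N by (simp add: s_def)
      finally have ks: "k * s \<le> t" .
      have xz: "norm (x - z) \<le> t * norm v"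
        using ks s by (simp add: x_def mult_right_mono)
      have xp: "norm (x - p) \<le> t * norm v"
        using infdist_le[OF z, of x] xz p(2) by (simp add: dist_norm)
      \<comment> \<open>As \<open>z\<close> itself lies in \<open>C\<close>, the nearest point
        \<open>p\<close> stays within the radius \<open>2 * t * norm v\<close> for which the
        hypothesis on normals is stated.\<close>
      have "norm (p - z) \<le> norm (p - x) + norm (x - z)"
        using norm_triangle_ineq[of "p - x" "x - z"] by simp
      then have pz: "norm (p - z) \<le> 2 * t * norm v"
        using xz xp by (simp add: norm_minus_commute)
      have "(x - p) \<bullet> v \<le> e * norm (x - p)"
        using C z by (intro e[OF p(1) pz] residual_in_regular_normal p) auto
      also have "\<dots> \<le> e * (t * norm v)" using xp e0 by (intro mult_left_mono)
      finally have xpv: "(x - p) \<bullet> v \<le> e * t * norm v" by simp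
      \<comment> \<open>The old nearest point serves as competitor for the next point of the
        segment; expanding the square leaves the normal term \<open>(x - p) \<bullet> v\<close> and
        an error of order \<open>s\<^sup>2\<close>.\<close>
      have "infdist (x + s *\<^sub>R v) C \<le> norm (x + s *\<^sub>R v - p)"
        using infdist_le[OF p(1)] by (simp add: dist_norm)
      moreover have "x + s *\<^sub>R v = z + (Suc k * s) *\<^sub>R v"
        by (simp add: x_def algebra_simps)
      ultimately have "g (Suc k) \<le> (norm ((x - p) + s *\<^sub>R v))\<^sup>2"
        unfolding g_def by (intro power_mono) (auto simp: algebra_simps infdist_nonneg)
      also have "\<dots> = (norm (x - p))\<^sup>2 + 2 * s * ((x - p) \<bullet> v) + s\<^sup>2 * (norm v)\<^sup>2"
        unfolding power2_norm_eq_inner by (simp add: inner_add_left inner_add_right inner_commute power2_eq_square)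
      also have "\<dots> \<le> g k + 2 * s * (e * t * norm v) + s\<^sup>2 * (norm v)\<^sup>2"
        using xpv s p(2) by (simp add: g_def x_def dist_norm)
      also have "\<dots> \<le> Suc k * (2 * s * e * t * norm v + s\<^sup>2 * (norm v)\<^sup>2)"
        using Suc by (simp add: algebra_simps)
      finally show ?case .
    qed
    have Ns: "N * s = t" using N by (simp add: s_def)
    have "(infdist (z + t *\<^sub>R v) C)\<^sup>2 = g N" by (simp only: g_def Ns)
    also have "\<dots> \<le> (N * s) * 2 * e * t * norm v + (N * s) * s * (norm v)\<^sup>2"
      using step[of N] by (simp add: algebra_simps power2_eq_square)
    also have "\<dots> = 2 * e * norm v * t\<^sup>2 + (norm v)\<^sup>2 * t\<^sup>2 * inverse (real (Suc M))"
      unfolding Ns by (simp add: s_def N_def power2_eq_square divide_inverse)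
    finally show ?thesis .
  qed
  have "(\<lambda>M. 2 * e * norm v * t\<^sup>2 + (norm v)\<^sup>2 * t\<^sup>2 * inverse (real (Suc M))) \<longlonglongrightarrow> 2 * e * norm v * t\<^sup>2 + (norm v)\<^sup>2 * t\<^sup>2 * 0"
    by (intro tendsto_intros LIMSEQ_inverse_real_of_nat)
  from LIMSEQ_le_const[OF this] bd show ?thesis by simp
qed

text \<open>Polarity at \<open>y\<close> alone extends, up to a small error, to all regular normals
  at nearby points of \<open>C\<close>. The growth estimate then makes the distance from
  \<open>z + t *\<^sub>R v\<close> to \<open>C\<close> uniformly small relative to
  \<open>t\<close>.\<close>

lemma limiting_normal_polar_subset_clarke_tangent:
  fixes C :: "'a::euclidean_space set"
  assumes C: "closed C" and v: "\<And>n. n \<in> limiting_normal C y \<Longrightarrow> n \<bullet> v \<le> 0"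
  shows "v \<in> clarke_tangent C y"
proof (rule clarke_tangentI[OF C])
  fix e :: real assume e: "e > 0"
  \<comment> \<open>Chosen so that the growth bound becomes \<open>(e * t)\<^sup>2\<close>; adding 1
    keeps the denominator positive when \<open>v = 0\<close>.\<close>
  define e' where "e' = e\<^sup>2 / (2 * (norm v + 1))"
  have nv: "norm v + 1 > 0" using norm_ge_zero[of v] by linarith
  have e': "e' > 0" using e nv by (simp add: e'_def)
  obtain \<delta> where \<delta>: "\<delta> > 0"
    "\<And>z n. z \<in> C \<Longrightarrow> norm (z - y) < \<delta> \<Longrightarrow> n \<in> regular_normal C z \<Longrightarrow> n \<bullet> v \<le> e' * norm n"
    using regular_normal_inner_le_near[OF v e'] by blast
  \<comment> \<open>Nearest points lie within \<open>2 * t * norm v\<close> of \<open>z\<close>, and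
    this radius keeps them within \<delta> of \<open>y\<close>.\<close>
  define \<delta>' where "\<delta>' = \<delta> / (2 * (norm v + 1))"
  have \<delta>': "\<delta>' > 0" "\<delta>' * (2 * (norm v + 1)) = \<delta>"
    using \<delta>(1) nv nonzero_divide_eq_eq[of "2 * (norm v + 1)" \<delta> \<delta>'] unfolding \<delta>'_def by auto
  have "infdist (z + t *\<^sub>R v) C \<le> e * t" if z: "z \<in> C" "norm (z - y) < \<delta>'" and t: "0 < t" "t < \<delta>'" for z t
  proof -
    have "(infdist (z + t *\<^sub>R v) C)\<^sup>2 \<le> 2 * e' * norm v * t\<^sup>2"
    proof (rule infdist_growth[OF C z(1) _ t(1)])
      fix p n assume p: "p \<in> C" "norm (p - z) \<le> 2 * t * norm v" and n: "n \<in> regular_normal C p"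
      have "norm (p - y) \<le> norm (p - z) + norm (z - y)"
        using norm_triangle_ineq[of "p - z" "z - y"] by simp
      also have "\<dots> < 2 * \<delta>' * norm v + 2 * \<delta>'"
        using p(2) z(2) \<delta>'(1) mult_right_mono[of "2 * t" "2 * \<delta>'" "norm v"] t norm_ge_zero[of v] by linarith
      also have "\<dots> = \<delta>" using \<delta>'(2) by (simp add: algebra_simps)
      finally show "n \<bullet> v \<le> e' * norm n" by (rule \<delta>(2)[OF p(1) _ n])
    qed (use e' in simp)
    also have "\<dots> \<le> 2 * e' * (norm v + 1) * t\<^sup>2"
      using e' by (intro mult_right_mono mult_left_mono) auto
    also have "2 * e' * (norm v + 1) = e\<^sup>2"
      using nonzero_divide_eq_eq[of "2 * (norm v + 1)" "e\<^sup>2" e'] nv e'_def by argo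
    also have "e\<^sup>2 * t\<^sup>2 = (e * t)\<^sup>2" by (simp add: power_mult_distrib)
    finally show ?thesis by (rule power2_le_imp_le) (use e t in simp)
  qed
  then show "\<exists>\<delta>>0. \<forall>z t. z \<in> C \<longrightarrow> norm (z - y) < \<delta> \<longrightarrow> 0 < t \<longrightarrow> t < \<delta> \<longrightarrow> infdist (z + t *\<^sub>R v) C \<le> e * t"
    using \<delta>'(1) by blast
qed

text \<open>A bipolar argument: a hyperplane separating \<open>m\<close> from the closed convex hull
  of the limiting normals has a normal \<open>a\<close> such that \<open>- a\<close> is polar to all
  of them. Hence \<open>- a\<close> is a Clarke tangent, and it violates the polarity of
  \<open>m\<close>.\<close>

lemma clarke_tangent_polar_subset_clarke_normal:
  fixes C :: "'a::euclidean_space set"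
  assumes C: "closed C" "y \<in> C" and m: "\<And>v. v \<in> clarke_tangent C y \<Longrightarrow> m \<bullet> v \<le> 0"
  shows "m \<in> clarke_normal C y"
proof (rule ccontr)
  let ?N = "closure (convex hull (limiting_normal C y))"
  assume "m \<notin> clarke_normal C y"
  then have "m \<notin> ?N" by (simp add: clarke_normal_def)
  then obtain a b where ab: "a \<bullet> m < b" "\<And>x. x \<in> ?N \<Longrightarrow> a \<bullet> x > b"
    using separating_hyperplane_closed_point[of ?N m] by (meson closed_closure convex_closure convex_convex_hull)
  have sub: "limiting_normal C y \<subseteq> ?N"
    by (meson closure_subset hull_subset order_trans)
  have b: "b < 0"
    using ab(2)[of 0] zero_in_limiting_normal[OF C(2)] sub by auto
  have "- a \<in> clarke_tangent C y"
  proof (rule limiting_normal_polar_subset_clarke_tangent[OF C(1)])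
    fix n assume n: "n \<in> limiting_normal C y"
    show "n \<bullet> - a \<le> 0"
    proof (rule ccontr)
      assume "\<not> n \<bullet> - a \<le> 0"
      then have an: "a \<bullet> n < 0" by (simp add: inner_commute)
      \<comment> \<open>This positive multiple of \<open>n\<close> lies exactly on the hyperplane
        \<open>a \<bullet> x = b\<close>, which the hull avoids.\<close>
      have "(b / (a \<bullet> n)) *\<^sub>R n \<in> ?N"
        using limiting_normal_cone[OF n, of "b / (a \<bullet> n)"] sub an b by (auto simp: divide_nonpos_neg)
      from ab(2)[OF this] an show False by simp
    qed
  qed
  from m[OF this] ab(1) b show False by (simp add: inner_commute)
qed

section \<open>The primal second-order condition and its dual\<close>

text \<open>The separating functional \<open>(m, \<alpha>)\<close> is taken in the span of the separated set: if \<open>\<alpha> = 0\<close>, the relative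
  interior point forces it to be orthogonal to that set, hence zero.\<close>
lemma affine_convex_duality:
  fixes A :: "'a::euclidean_space \<Rightarrow> 'w::euclidean_space" and c :: "'a \<Rightarrow> real"
  assumes A: "linear A" and c: "linear c" and T: "convex T"
    and primal: "\<And>w. A w + b \<in> T \<Longrightarrow> 0 \<le> c w + \<gamma>"
    and ri: "A w0 + b \<in> rel_interior T"
  shows "\<exists>m. (\<forall>w. c w + m \<bullet> A w = 0) \<and> (\<forall>\<tau>\<in>T. m \<bullet> \<tau> \<le> m \<bullet> b + \<gamma>)"
proof -
  \<comment> \<open>Pairs of a constraint residual and a number strictly above the objective. The
    origin belongs to \<open>D\<close> only if some feasible \<open>w\<close> has a negative
    objective.\<close>
  define D where "D = (\<lambda>(w, \<tau>, r). (A w + b - \<tau>, c w + \<gamma> + r)) ` (UNIV \<times> T \<times> {0<..})"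
  have \<tau>0: "A w0 + b \<in> T" using ri rel_interior_subset by blast
  have "D = (+) (b, \<gamma>) ` ((\<lambda>(w, \<tau>, r). (A w - \<tau>, c w + r)) ` (UNIV \<times> T \<times> {0<..}))"
    unfolding D_def image_image by (intro image_cong) (auto simp: algebra_simps)
  moreover have "linear (\<lambda>(w, \<tau>, r). (A w - \<tau>, c w + r))"
    using A c by (auto intro!: linearI simp: linear_add linear_scale algebra_simps)
  then have "convex ((\<lambda>(w, \<tau>, r). (A w - \<tau>, c w + r)) ` (UNIV \<times> T \<times> {0<..}))"
    using convex_Times[OF convex_UNIV convex_Times[OF T convex_real_interval(3)]] by (rule convex_linear_image)
  ultimately have "convex D" by (simp only: convex_translation)
  moreover have "D \<noteq> {}" using \<tau>0 by (force simp: D_def)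
  moreover have "0 \<notin> D"
  proof
    assume "0 \<in> D"
    then obtain w \<tau> r where "\<tau> \<in> T" "r > 0" "A w + b = \<tau>" "c w + \<gamma> + r = 0"
      by (auto simp: D_def zero_prod_def)
    with primal[of w] show False by auto
  qed
  ultimately obtain a where a: "a \<in> span D" "a \<noteq> 0" "\<And>x. x \<in> D \<Longrightarrow> 0 \<le> a \<bullet> x"
    using separating_hyperplane_set_0_inspan by blast
  obtain m \<alpha> where ma: "a = (m, \<alpha>)" by force
  have sep: "0 \<le> m \<bullet> (A w + b - \<tau>) + \<alpha> * (c w + \<gamma> + r)" if "\<tau> \<in> T" "r > 0" for w \<tau> r
  proof -
    have "(A w + b - \<tau>, c w + \<gamma> + r) \<in> D"
      unfolding D_def using that by (intro image_eqI[of _ _ "(w, \<tau>, r)"]) auto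
    from a(3)[OF this] show ?thesis by (simp add: ma)
  qed
  \<comment> \<open>A linear functional bounded below vanishes: otherwise some multiple of
    \<open>w\<close> has the value \<open>- (B + 1)\<close>.\<close>
  have lin_bound: "f w = 0" if "\<And>w. 0 \<le> f w + B" "linear f" for f :: "'a \<Rightarrow> real" and B w
  proof (rule ccontr)
    assume "f w \<noteq> 0"
    moreover have "0 \<le> (- (B + 1) / f w) * f w + B"
      using that(1)[of "(- (B + 1) / f w) *\<^sub>R w"] linear_scale[OF that(2)] by simp
    ultimately show False by simp
  qed
  have "\<alpha> \<ge> 0"
  proof (rule ccontr)
    assume "\<not> \<alpha> \<ge> 0"
    then have neg: "\<alpha> < 0" by simp
    define M where "M = m \<bullet> (A 0 + b - (A w0 + b)) + \<alpha> * (c 0 + \<gamma>)"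
    have ge: "0 \<le> M + \<alpha> * r" if "r > 0" for r
      using sep[OF \<tau>0 that, of 0] by (simp add: M_def algebra_simps)
    \<comment> \<open>With this \<open>r\<close> the separation inequality would read
      \<open>0 \<le> M - \<bar>M\<bar> - 1\<close>.\<close>
    have "(\<bar>M\<bar> + 1) / - \<alpha> > 0" using neg by (intro divide_pos_pos) auto
    moreover have "\<alpha> * ((\<bar>M\<bar> + 1) / - \<alpha>) = - (\<bar>M\<bar> + 1)" using neg by (simp add: field_simps)
    ultimately show False using ge[of "(\<bar>M\<bar> + 1) / - \<alpha>"] by linarith
  qed
  have linm: "linear (\<lambda>w. m \<bullet> A w)"
    using A by (auto intro!: linearI simp: linear_add linear_scale inner_add_right)
  have "\<alpha> \<noteq> 0"
  proof
    assume \<alpha>: "\<alpha> = 0"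
    have mA: "m \<bullet> A w = 0" for w
      by (rule lin_bound[where B = "m \<bullet> (b - (A w0 + b))", OF _ linm])
        (use sep[OF \<tau>0, of 1] \<alpha> in \<open>simp add: inner_diff_right inner_add_right algebra_simps\<close>)
    have le: "m \<bullet> \<tau> \<le> m \<bullet> b" if "\<tau> \<in> T" for \<tau>
      using sep[OF that, of 1 0] \<alpha> mA[of 0] by (simp add: inner_diff_right inner_add_right)
    have eq: "m \<bullet> \<tau> = m \<bullet> b" if \<tau>: "\<tau> \<in> T" for \<tau>
    proof -
      \<comment> \<open>The segment from \<tau> can be prolonged beyond the relative interior point,
        where \<open>m\<close> already attains its upper bound \<open>m \<bullet> b\<close> on
        \<open>T\<close>. So \<open>m\<close> cannot be smaller at \<tau>.\<close>
      obtain e where e: "e > 1" "(1 - e) *\<^sub>R \<tau> + e *\<^sub>R (A w0 + b) \<in> T"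
        using ri \<tau> convex_rel_interior_iff[OF T] by blast
      have "(1 - e) * (m \<bullet> \<tau>) + e * (m \<bullet> b) \<le> m \<bullet> b"
        using le[OF e(2)] mA[of w0] by (simp add: inner_add_right)
      then have "(e - 1) * (m \<bullet> b - m \<bullet> \<tau>) \<le> 0" by (simp add: algebra_simps)
      with e(1) have "m \<bullet> b \<le> m \<bullet> \<tau>" by (simp add: mult_le_0_iff)
      with le[OF \<tau>] show ?thesis by simp
    qed
    have "orthogonal a x" if "x \<in> D" for x
      using that eq mA \<alpha> by (auto simp: D_def ma orthogonal_def inner_diff_right inner_add_right)
    then have "orthogonal a a" using orthogonal_to_span[OF a(1)] by blast
    with a(2) show False by (simp add: orthogonal_def)
  qed
  with \<open>\<alpha> \<ge> 0\<close> have \<alpha>: "\<alpha> > 0" by simp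
  define m' where "m' = (1 / \<alpha>) *\<^sub>R m"
  \<comment> \<open>After normalising the objective weight to 1, the strictly positive slack
    \<open>r\<close> is sent to 0.\<close>
  have sep': "0 \<le> m' \<bullet> (A w + b - \<tau>) + (c w + \<gamma>)" if \<tau>: "\<tau> \<in> T" for w \<tau>
  proof (rule field_le_epsilon)
    fix e :: real assume e: "e > 0"
    have "0 \<le> (1 / \<alpha>) * (m \<bullet> (A w + b - \<tau>) + \<alpha> * (c w + \<gamma> + e))"
      using sep[OF \<tau> e, of w] \<alpha> by (intro mult_nonneg_nonneg) auto
    also have "\<dots> = m' \<bullet> (A w + b - \<tau>) + (c w + \<gamma>) + e"
      using \<alpha> by (simp add: m'_def distrib_left)
    finally show "0 \<le> m' \<bullet> (A w + b - \<tau>) + (c w + \<gamma>) + e" .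
  qed
  have linm': "linear (\<lambda>w. c w + m' \<bullet> A w)"
    using A c by (auto intro!: linearI simp: linear_add linear_scale inner_add_right algebra_simps)
  have stat: "c w + m' \<bullet> A w = 0" for w
    by (rule lin_bound[where B = "m' \<bullet> (b - (A w0 + b)) + \<gamma>", OF _ linm'])
      (use sep'[OF \<tau>0] in \<open>simp add: inner_diff_right inner_add_right algebra_simps\<close>)
  moreover have "m' \<bullet> \<tau> \<le> m' \<bullet> b + \<gamma>" if "\<tau> \<in> T" for \<tau>
    using sep'[OF that, of 0] stat[of 0] by (simp add: inner_diff_right inner_add_right)
  ultimately show ?thesis by blast
qed

text \<open>Projecting the points of the parabola onto \<open>C\<close> moves them by
  \<open>o(t\<^sup>2)\<close>, which a perturbation \<open>u k\<close> of \<open>w\<close> absorbs.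
  Conversely, returning from \<open>u k\<close> to \<open>w\<close> costs
  \<open>t\<^sup>2 / 2\<close> times \<open>norm (u k - w)\<close>.\<close>

lemma outer_so_tangent_iff:
  fixes C :: "'a::euclidean_space set"
  assumes C: "closed C" "C \<noteq> {}"
  shows "w \<in> outer_so_tangent C y v \<longleftrightarrow> (\<exists>t u. (\<forall>k. t k > 0) \<and> t \<longlonglongrightarrow> 0 \<and> u \<longlonglongrightarrow> w
      \<and> (\<forall>k. y + t k *\<^sub>R v + ((t k)\<^sup>2 / 2) *\<^sub>R u k \<in> C))" (is "?L \<longleftrightarrow> ?R")
proof
  assume ?L
  then obtain t where t: "\<And>k. t k > 0" "t \<longlonglongrightarrow> 0"
    "(\<lambda>k. infdist (y + t k *\<^sub>R v + ((t k)\<^sup>2 / 2) *\<^sub>R w) C / (t k)\<^sup>2) \<longlonglongrightarrow> 0"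
    unfolding outer_so_tangent_def by blast
  define z where "z k = y + t k *\<^sub>R v + ((t k)\<^sup>2 / 2) *\<^sub>R w" for k
  have "\<exists>p\<in>C. infdist (z k) C = dist (z k) p" for k
    using infdist_attains_inf[OF C] by metis
  then obtain p where p: "\<And>k. p k \<in> C" "\<And>k. infdist (z k) C = dist (z k) (p k)" by metis
  define u where "u k = w + (2 / (t k)\<^sup>2) *\<^sub>R (p k - z k)" for k
  have t0: "t k \<noteq> 0" for k using t(1)[of k] by simp
  have "(\<lambda>k. norm (u k - w)) = (\<lambda>k. 2 * (infdist (z k) C / (t k)\<^sup>2))"
  proof
    fix k
    show "norm (u k - w) = 2 * (infdist (z k) C / (t k)\<^sup>2)"
      using norm_minus_commute[of "p k" "z k"] by (simp add: u_def p(2) dist_norm)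
  qed
  moreover have "(\<lambda>k. 2 * (infdist (z k) C / (t k)\<^sup>2)) \<longlonglongrightarrow> 0"
    using tendsto_mult_right_zero[OF t(3), of 2] unfolding z_def .
  ultimately have "(\<lambda>k. norm (u k - w)) \<longlonglongrightarrow> 0" by simp
  then have "(\<lambda>k. u k - w) \<longlonglongrightarrow> 0" by (rule tendsto_norm_zero_cancel)
  then have "u \<longlonglongrightarrow> w" by (rule LIM_zero_cancel)
  moreover have "y + t k *\<^sub>R v + ((t k)\<^sup>2 / 2) *\<^sub>R u k = p k" for k
  proof -
    have "((t k)\<^sup>2 / 2) *\<^sub>R u k = ((t k)\<^sup>2 / 2) *\<^sub>R w + (p k - z k)"
      using t0[of k] by (simp add: u_def scaleR_add_right)
    then show ?thesis by (simp add: z_def)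
  qed
  ultimately have "y + t k *\<^sub>R v + ((t k)\<^sup>2 / 2) *\<^sub>R u k \<in> C" for k by (simp add: p(1))
  with \<open>u \<longlonglongrightarrow> w\<close> show ?R using t by (intro exI[of _ t] exI[of _ u]) auto
next
  assume ?R
  then obtain t u where t: "\<And>k. t k > 0" "t \<longlonglongrightarrow> 0" and u: "u \<longlonglongrightarrow> w"
      and C': "\<And>k. y + t k *\<^sub>R v + ((t k)\<^sup>2 / 2) *\<^sub>R u k \<in> C" by blast
  have u0: "(\<lambda>k. norm (u k - w)) \<longlonglongrightarrow> 0" using u by (simp add: LIM_zero tendsto_norm_zero)
  have le: "infdist (y + t k *\<^sub>R v + ((t k)\<^sup>2 / 2) *\<^sub>R w) C / (t k)\<^sup>2 \<le> norm (u k - w)" for k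
  proof -
    have "infdist (y + t k *\<^sub>R v + ((t k)\<^sup>2 / 2) *\<^sub>R w) C
        \<le> dist (y + t k *\<^sub>R v + ((t k)\<^sup>2 / 2) *\<^sub>R w) (y + t k *\<^sub>R v + ((t k)\<^sup>2 / 2) *\<^sub>R u k)"
      by (rule infdist_le[OF C'])
    also have "\<dots> = (t k)\<^sup>2 / 2 * norm (u k - w)"
    proof -
      have "(t k)\<^sup>2 / 2 * norm (u k - w) = norm (((t k)\<^sup>2 / 2) *\<^sub>R (w - u k))"
        by (simp add: norm_minus_commute)
      then show ?thesis by (simp only: dist_norm scaleR_diff_right add_diff_cancel_left)
    qed
    also have "\<dots> \<le> (t k)\<^sup>2 * norm (u k - w)" by (intro mult_right_mono) auto
    finally show ?thesis using t(1)[of k] by (simp add: divide_le_eq mult.commute)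
  qed
  have nle: "norm (infdist (y + t k *\<^sub>R v + ((t k)\<^sup>2 / 2) *\<^sub>R w) C / (t k)\<^sup>2) \<le> norm (u k - w)" for k
    using le[of k] by (simp add: infdist_nonneg)
  have "(\<lambda>k. infdist (y + t k *\<^sub>R v + ((t k)\<^sup>2 / 2) *\<^sub>R w) C / (t k)\<^sup>2) \<longlonglongrightarrow> 0"
    by (rule Lim_null_comparison[OF _ u0]) (use nle in simp)
  then show ?L unfolding outer_so_tangent_def using t by (intro CollectI exI[of _ t]) auto
qed

text \<open>The points of \<open>C\<close> on the perturbed parabola converge to \<open>y\<close>,
  so they serve as base points for the Clarke tangent \<open>u\<close> with step sizes
  \<open>(t k)\<^sup>2 / 2\<close>. The extra move adds to the second-order term.\<close>

lemma outer_so_tangent_add_clarke_tangent: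
  fixes C :: "'a::euclidean_space set"
  assumes C: "closed C" and w: "w \<in> outer_so_tangent C y v" and u: "u \<in> clarke_tangent C y" and y: "y \<in> C"
  shows "w + u \<in> outer_so_tangent C y v"
proof -
  have C0: "C \<noteq> {}" using y by auto
  obtain t a where t: "\<And>k. t k > 0" "t \<longlonglongrightarrow> 0" and a: "a \<longlonglongrightarrow> w"
      and aC: "\<And>k. y + t k *\<^sub>R v + ((t k)\<^sup>2 / 2) *\<^sub>R a k \<in> C"
    using w unfolding outer_so_tangent_iff[OF C C0] by blast
  have s0: "(\<lambda>k. (t k)\<^sup>2 / 2) \<longlonglongrightarrow> 0" using tendsto_divide[OF tendsto_power[OF t(2), of 2] tendsto_const[of 2]] by simp
  have s: "(t k)\<^sup>2 / 2 > 0" for k using t(1)[of k] by simp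
  have "(\<lambda>k. y + t k *\<^sub>R v + ((t k)\<^sup>2 / 2) *\<^sub>R a k) \<longlonglongrightarrow> y + 0 *\<^sub>R v + 0 *\<^sub>R w"
    by (intro tendsto_intros t s0 a)
  then have "\<exists>b. b \<longlonglongrightarrow> u \<and> (\<forall>k. y + t k *\<^sub>R v + ((t k)\<^sup>2 / 2) *\<^sub>R a k + ((t k)\<^sup>2 / 2) *\<^sub>R b k \<in> C)"
    using u[unfolded clarke_tangent_def, THEN CollectD, rule_format, of "\<lambda>k. (t k)\<^sup>2 / 2"] s s0 aC by simp
  then obtain b where b: "b \<longlonglongrightarrow> u" "\<And>k. y + t k *\<^sub>R v + ((t k)\<^sup>2 / 2) *\<^sub>R a k + ((t k)\<^sup>2 / 2) *\<^sub>R b k \<in> C"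
    by blast
  have "\<And>k. y + t k *\<^sub>R v + ((t k)\<^sup>2 / 2) *\<^sub>R (a k + b k) \<in> C"
    using b(2) by (simp add: scaleR_add_right add.assoc)
  then show ?thesis
    unfolding outer_so_tangent_iff[OF C C0] using t tendsto_add[OF a b(1)]
    by (intro exI[of _ t] exI[of _ "\<lambda>k. a k + b k"]) auto
qed

text \<open>If \<open>U (x k)\<close> is within \<open>o(s k)\<close> of \<open>C\<close>,
  subregularity provides a feasible point within \<open>o(s k)\<close> of \<open>x k\<close>. The
  scale is \<open>t k\<close> for first-order tangents and \<open>(t k)\<^sup>2 / 2\<close> for
  second-order ones.\<close>

lemma metrically_subregular_lift:
  fixes U :: "'x::euclidean_space \<Rightarrow> 'w::euclidean_space"
  assumes C: "closed C" and U: "continuous_on UNIV U" and x0: "U x0 \<in> C"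
    and sub: "metrically_subregular U C x0"
    and x: "x \<longlonglongrightarrow> x0" and yC: "\<And>k. y k \<in> C" and s: "\<And>k. s k > 0"
    and lim: "(\<lambda>k. (1 / s k) *\<^sub>R (U (x k) - y k)) \<longlonglongrightarrow> 0"
  shows "\<exists>r. r \<longlonglongrightarrow> 0 \<and> (\<forall>k. U (x k + s k *\<^sub>R r k) \<in> C)"
proof -
  obtain \<kappa> \<rho> where \<kappa>: "\<kappa> > 0" "\<rho> > 0" 
    "\<And>x. norm (x - x0) \<le> \<rho> \<Longrightarrow> infdist x {z. U z \<in> C} \<le> \<kappa> * infdist (U x) C"
    using sub unfolding metrically_subregular_def by blast
  have "closed {z. U z \<in> C}"
    using continuous_on_closed_vimage[of UNIV U] U C by (simp add: vimage_def)
  then have "\<exists>p. U p \<in> C \<and> infdist (x k) {z. U z \<in> C} = dist (x k) p" for k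
    using infdist_attains_inf x0 by (metis empty_iff mem_Collect_eq)
  then obtain p where p: "\<And>k. U (p k) \<in> C" "\<And>k. infdist (x k) {z. U z \<in> C} = dist (x k) (p k)" by metis
  define r where "r k = (1 / s k) *\<^sub>R (p k - x k)" for k
  have s0: "s k \<noteq> 0" for k using s[of k] by simp
  have "eventually (\<lambda>k. norm (r k) \<le> norm ((1 / s k) *\<^sub>R (U (x k) - y k)) * \<kappa>) sequentially"
    using tendstoD[OF x \<kappa>(2)]
  proof eventually_elim
    case (elim k)
    have "dist (x k) (p k) \<le> \<kappa> * infdist (U (x k)) C"
      using \<kappa>(3)[of "x k"] elim p(2) by (simp add: dist_norm)
    also have "\<dots> \<le> \<kappa> * norm (U (x k) - y k)"
      using infdist_le[OF yC[of k], of "U (x k)"] \<kappa>(1) by (simp add: dist_norm)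
    finally have "norm (p k - x k) / s k \<le> \<kappa> * norm (U (x k) - y k) / s k"
      using s[of k] by (intro divide_right_mono) (auto simp: dist_norm norm_minus_commute)
    then show ?case using s[of k] by (simp add: r_def mult.commute)
  qed
  moreover have "(\<lambda>k. norm ((1 / s k) *\<^sub>R (U (x k) - y k)) * \<kappa>) \<longlonglongrightarrow> 0"
    using tendsto_mult_left_zero[OF tendsto_norm_zero[OF lim]] .
  ultimately have "r \<longlonglongrightarrow> 0"
    by (rule Lim_null_comparison)
  moreover have "x k + s k *\<^sub>R r k = p k" for k using s0 by (simp add: r_def)
  ultimately show ?thesis using p(1) by (intro exI[of _ r]) auto
qed

text \<open>Subregularity turns the linearised tangent direction into a feasible sequence with
  directions \<open>d + r k\<close> tending to \<open>d\<close>, along which \<phi> cannot drop. For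
  a critical \<open>d\<close> this forces \<open>\<phi>' d = 0\<close>.\<close>

lemma critical_direction_derivative_nonneg:
  fixes U :: "'x::euclidean_space \<Rightarrow> 'w::euclidean_space" and \<phi> :: "'x \<Rightarrow> real"
  assumes C: "closed C" and dU: "\<And>x. (U has_derivative U' x) (at x)"
    and d\<phi>: "(\<phi> has_derivative \<phi>') (at x0)"
    and locmin: "local_minimizer \<phi> {x. U x \<in> C} x0"
    and sub: "metrically_subregular U C x0"
    and d: "U' x0 d \<in> bouligand_tangent C (U x0)"
  shows "0 \<le> \<phi>' d"
proof -
  have x0: "U x0 \<in> C" using locmin by (simp add: local_minimizer_def)
  obtain e where e: "e > 0" "\<And>x. U x \<in> C \<Longrightarrow> dist x x0 < e \<Longrightarrow> \<phi> x0 \<le> \<phi> x"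
    using locmin by (auto simp: local_minimizer_def)
  have cont: "continuous_on UNIV U"
    using dU by (meson continuous_at_imp_continuous_on has_derivative_continuous)
  obtain t w where t: "\<And>k. t k > 0" "t \<longlonglongrightarrow> 0" and w: "w \<longlonglongrightarrow> U' x0 d" "\<And>k. U x0 + t k *\<^sub>R w k \<in> C"
    using d unfolding bouligand_tangent_def by blast
  have td: "(\<lambda>k. x0 + t k *\<^sub>R d) \<longlonglongrightarrow> x0 + 0 *\<^sub>R d" by (intro tendsto_intros t)
  have "(\<lambda>k. (1 / t k) *\<^sub>R (U (x0 + t k *\<^sub>R d) - U x0) - w k) \<longlonglongrightarrow> U' x0 d - U' x0 d"
    by (intro tendsto_diff w has_derivative_along_sequence[OF dU] t) auto
  moreover have "(1 / t k) *\<^sub>R (U (x0 + t k *\<^sub>R d) - U x0) - w k = (1 / t k) *\<^sub>R (U (x0 + t k *\<^sub>R d) - (U x0 + t k *\<^sub>R w k))" for k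
    using t(1)[of k] by (simp add: algebra_simps)
  ultimately obtain r where r: "r \<longlonglongrightarrow> 0" "\<And>k. U (x0 + t k *\<^sub>R d + t k *\<^sub>R r k) \<in> C"
    using metrically_subregular_lift[OF C cont x0 sub, of "\<lambda>k. x0 + t k *\<^sub>R d" "\<lambda>k. U x0 + t k *\<^sub>R w k" t] t td w(2)
    by auto
  have dr: "(\<lambda>k. d + r k) \<longlonglongrightarrow> d" using tendsto_add[OF tendsto_const r(1)] by simp
  have "(\<lambda>k. t k *\<^sub>R (d + r k)) \<longlonglongrightarrow> 0" using tendsto_scaleR[OF t(2) dr] by simp
  from tendstoD[OF this e(1)]
  have "eventually (\<lambda>k. 0 \<le> (1 / t k) *\<^sub>R (\<phi> (x0 + t k *\<^sub>R (d + r k)) - \<phi> x0)) sequentially"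
  proof eventually_elim
    case (elim k)
    show ?case using e(2)[of "x0 + t k *\<^sub>R (d + r k)"] r(2)[of k] elim t(1)[of k]
      by (simp add: dist_norm scaleR_add_right add.assoc)
  qed
  then show ?thesis
    by (rule tendsto_lowerbound[OF has_derivative_along_sequence[OF d\<phi> t dr]]) auto
qed

text \<open>The second-order tangent puts \<open>U\<close> of the arc
  \<open>x0 + t d + (t\<^sup>2 / 2) w\<close> within \<open>o(t\<^sup>2)\<close> of
  \<open>C\<close>, and subregularity repairs \<open>w\<close> by a null sequence. Since
  \<open>\<phi>' x0 d = 0\<close>, the second-order term decides the sign of the increment of
  \<phi>.\<close>

lemma primal_second_order_condition:
  fixes U :: "'x::euclidean_space \<Rightarrow> 'w::euclidean_space" and \<phi> :: "'x \<Rightarrow> real"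
  assumes C: "closed C" 
    and dU: "\<And>x. (U has_derivative U' x) (at x)"
    and d2U: "\<And>x u. ((\<lambda>y. U' y u) has_derivative U'' x u) (at x)"
    and d\<phi>: "\<And>x. (\<phi> has_derivative \<phi>' x) (at x)"
    and d2\<phi>: "\<And>x u. ((\<lambda>y. \<phi>' y u) has_derivative \<phi>'' x u) (at x)"
    and locmin: "local_minimizer \<phi> {x. U x \<in> C} x0"
    and sub: "metrically_subregular U C x0"
    and d: "\<phi>' x0 d = 0"
    and w: "U' x0 w + U'' x0 d d \<in> outer_so_tangent C (U x0) (U' x0 d)"
  shows "0 \<le> \<phi>' x0 w + \<phi>'' x0 d d"
proof -
  have x0: "U x0 \<in> C" using locmin by (simp add: local_minimizer_def)
  then have C0: "C \<noteq> {}" by auto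
  obtain e where e: "e > 0" "\<And>x. U x \<in> C \<Longrightarrow> dist x x0 < e \<Longrightarrow> \<phi> x0 \<le> \<phi> x"
    using locmin by (auto simp: local_minimizer_def)
  have cont: "continuous_on UNIV U"
    using dU by (meson continuous_at_imp_continuous_on has_derivative_continuous)
  obtain t u where t: "\<And>k. t k > 0" "t \<longlonglongrightarrow> 0" and u: "u \<longlonglongrightarrow> U' x0 w + U'' x0 d d"
      and uC: "\<And>k. U x0 + t k *\<^sub>R U' x0 d + ((t k)\<^sup>2 / 2) *\<^sub>R u k \<in> C"
    using w unfolding outer_so_tangent_iff[OF C C0] by blast
  define s where "s k = (t k)\<^sup>2 / 2" for k
  have s: "s k > 0" for k using t(1)[of k] by (simp add: s_def)
  have s0: "s \<longlonglongrightarrow> 0"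
    unfolding s_def using tendsto_divide[OF tendsto_power[OF t(2), of 2] tendsto_const[of 2]] by simp
  define x where "x k = x0 + t k *\<^sub>R d + s k *\<^sub>R w" for k
  have "x \<longlonglongrightarrow> x0 + 0 *\<^sub>R d + 0 *\<^sub>R w" unfolding x_def by (intro tendsto_intros t s0)
  then have x: "x \<longlonglongrightarrow> x0" by simp
  define y where "y k = U x0 + t k *\<^sub>R U' x0 d + s k *\<^sub>R u k" for k
  have "(\<lambda>k. (1 / s k) *\<^sub>R (U (x k) - U x0 - t k *\<^sub>R U' x0 d) - u k) \<longlonglongrightarrow> (U' x0 w + U'' x0 d d) - (U' x0 w + U'' x0 d d)"
    using second_order_expansion_along_sequence[OF dU d2U t tendsto_const[of w], of x0 d]
    by (intro tendsto_diff u) (simp add: x_def s_def)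
  moreover have "(1 / s k) *\<^sub>R (U (x k) - U x0 - t k *\<^sub>R U' x0 d) - u k = (1 / s k) *\<^sub>R (U (x k) - y k)" for k
  proof -
    have "s k \<noteq> 0" using s[of k] by simp
    then have "u k = (1 / s k) *\<^sub>R (s k *\<^sub>R u k)" by simp
    then show ?thesis unfolding y_def by (metis (no_types, lifting) scaleR_diff_right diff_diff_add)
  qed
  ultimately obtain r where r: "r \<longlonglongrightarrow> 0" "\<And>k. U (x k + s k *\<^sub>R r k) \<in> C"
    using metrically_subregular_lift[OF C cont x0 sub x, of y s] s uC by (auto simp: y_def s_def)
  have wr: "(\<lambda>k. w + r k) \<longlonglongrightarrow> w" using tendsto_add[OF tendsto_const r(1)] by simp
  define z where "z k = x0 + t k *\<^sub>R d + ((t k)\<^sup>2 / 2) *\<^sub>R (w + r k)" for k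
  have zx: "z k = x k + s k *\<^sub>R r k" for k by (simp add: z_def x_def s_def scaleR_add_right)
  have "z \<longlonglongrightarrow> x0 + 0 *\<^sub>R 0" unfolding zx by (intro tendsto_intros x s0 r)
  then have "z \<longlonglongrightarrow> x0" by simp
  from tendstoD[OF this e(1)]
  have "eventually (\<lambda>k. 0 \<le> (2 / (t k)\<^sup>2) *\<^sub>R (\<phi> (z k) - \<phi> x0 - t k *\<^sub>R \<phi>' x0 d)) sequentially"
  proof eventually_elim
    case (elim k)
    show ?case using e(2)[of "z k"] r(2)[of k] elim by (simp add: d zx)
  qed
  then show ?thesis
    by (rule tendsto_lowerbound[OF second_order_expansion_along_sequence[OF d\<phi> d2\<phi> t wr, of x0 d, folded z_def]]) auto
qed

section \<open>Existence of multipliers\<close>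

text \<open>The second derivative at \<open>x0\<close> bounds \<open>\<phi>'\<close> uniformly on a
  small ball, and the mean value inequality does the rest.\<close>

lemma locally_lipschitz_of_twice_differentiable:
  fixes \<phi> :: "'x::euclidean_space \<Rightarrow> real"
  assumes d\<phi>: "\<And>x. (\<phi> has_derivative \<phi>' x) (at x)"
    and d2\<phi>: "\<And>x u. ((\<lambda>y. \<phi>' y u) has_derivative \<phi>'' x u) (at x)"
  shows "\<exists>L>0. \<exists>r>0. \<forall>x\<in>ball x0 r. \<forall>y\<in>ball x0 r. \<bar>\<phi> x - \<phi> y\<bar> \<le> L * norm (x - y)"
proof -
  have lin: "linear (\<phi>' y)" for y using d\<phi> has_derivative_linear by blast
  have lin2: "linear (\<lambda>u. \<phi>'' x u v)" for x v by (rule linear_second_derivative[OF d\<phi> d2\<phi>])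
  have "bounded_bilinear (\<phi>'' x0)"
    using has_derivative_linear[OF d2\<phi>] lin2 by (simp add: bilinear_conv_bounded_bilinear[symmetric] bilinear_def)
  then obtain B2 where B2: "B2 > 0" "\<And>u v. norm (\<phi>'' x0 u v) \<le> norm u * norm v * B2"
    using bounded_bilinear.pos_bounded by blast
  obtain B1 where B1: "B1 > 0" "\<And>u. norm (\<phi>' x0 u) \<le> norm u * B1"
    using bounded_linear.pos_bounded[OF has_derivative_bounded_linear[OF d\<phi>]] by blast
  obtain \<delta> where \<delta>: "\<delta> > 0"
    "\<And>v u. norm v < \<delta> \<Longrightarrow> norm (\<phi>' (x0 + v) u - \<phi>' x0 u - \<phi>'' x0 u v) \<le> 1 * norm v * norm u"
    using has_derivative_uniform_in_direction[OF lin lin2 d2\<phi>, of 1 x0] by auto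
  \<comment> \<open>The summands bound \<open>\<phi>' x0\<close>, the second-derivative correction,
    and the remainder with tolerance 1, for displacements shorter than \<delta>.\<close>
  define L where "L = B1 + \<delta> * B2 + \<delta>"
  have "norm (\<phi> x - \<phi> y) \<le> L * norm (x - y)" if "x \<in> ball x0 \<delta>" "y \<in> ball x0 \<delta>" for x y
  proof (rule differentiable_bound[OF convex_ball has_derivative_at_withinI[OF d\<phi>] _ that])
    fix z assume "z \<in> ball x0 \<delta>"
    then have z: "norm (z - x0) < \<delta>" by (simp add: dist_norm norm_minus_commute)
    show "onorm (\<phi>' z) \<le> L"
    proof (rule onorm_le)
      fix u
      have "norm (\<phi>' z u) \<le> norm (\<phi>' z u - \<phi>' x0 u - \<phi>'' x0 u (z - x0)) + norm (\<phi>' x0 u) + norm (\<phi>'' x0 u (z - x0))"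
        by simp
      also have "\<dots> \<le> norm (z - x0) * norm u + norm u * B1 + norm u * norm (z - x0) * B2"
        using \<delta>(2)[OF z, of u] B1(2)[of u] B2(2)[of u "z - x0"] by simp
      also have "\<dots> \<le> \<delta> * norm u + norm u * B1 + norm u * \<delta> * B2"
        using z B2 by (intro add_mono mult_right_mono mult_left_mono) auto
      finally show "norm (\<phi>' z u) \<le> L * norm u" by (simp add: L_def algebra_simps)
    qed
  qed
  moreover have "L > 0" using B1 B2 \<delta> by (simp add: L_def add_pos_pos)
  ultimately show ?thesis using \<delta>(1) by (metis real_norm_def)
qed

text \<open>Passing from \<open>x\<close> to a nearest feasible point changes \<phi> by at most
  \<open>L\<close> times the distance, which subregularity bounds by \<kappa> times the constraint
  violation.\<close>

lemma exact_penalty: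
  fixes U :: "'x::euclidean_space \<Rightarrow> 'w::euclidean_space" and \<phi> :: "'x \<Rightarrow> real"
  assumes C: "closed C" and U: "continuous_on UNIV U"
    and lip: "L > 0" "r > 0" "\<And>x y. x \<in> ball x0 r \<Longrightarrow> y \<in> ball x0 r \<Longrightarrow> \<bar>\<phi> x - \<phi> y\<bar> \<le> L * norm (x - y)"
    and locmin: "local_minimizer \<phi> {x. U x \<in> C} x0"
    and sub: "metrically_subregular U C x0"
  shows "\<exists>M>0. \<exists>s>0. \<forall>x y. norm (x - x0) < s \<longrightarrow> y \<in> C \<longrightarrow> \<phi> x0 \<le> \<phi> x + M * norm (U x - y)"
proof -
  have x0: "U x0 \<in> C" using locmin by (simp add: local_minimizer_def)
  obtain e where e: "e > 0" "\<And>x. U x \<in> C \<Longrightarrow> dist x x0 < e \<Longrightarrow> \<phi> x0 \<le> \<phi> x"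
    using locmin by (auto simp: local_minimizer_def)
  obtain \<kappa> \<rho> where \<kappa>: "\<kappa> > 0" "\<rho> > 0" 
    "\<And>x. norm (x - x0) \<le> \<rho> \<Longrightarrow> infdist x {z. U z \<in> C} \<le> \<kappa> * infdist (U x) C"
    using sub unfolding metrically_subregular_def by blast
  have cl: "closed {z. U z \<in> C}"
    using continuous_on_closed_vimage[of UNIV U] U C by (simp add: vimage_def)
  \<comment> \<open>Halved because the nearest feasible point may be twice as far from
    \<open>x0\<close> as \<open>x\<close> is.\<close>
  define s where "s = min \<rho> (min r e / 2)"
  have "\<phi> x0 \<le> \<phi> x + (L * \<kappa>) * norm (U x - y)" if x: "norm (x - x0) < s" and y: "y \<in> C" for x y
  proof -
    obtain p where p: "U p \<in> C" "infdist x {z. U z \<in> C} = dist x p"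
      using infdist_attains_inf[OF cl, of x] x0 by auto
    have xp: "dist x p \<le> dist x x0"
      using infdist_le[of x0 "{z. U z \<in> C}" x] x0 p(2) by simp
    have "dist p x0 \<le> dist x p + dist x x0"
      using dist_triangle[of p x0 x] by (simp add: dist_commute)
    then have px0: "dist p x0 < min r e"
      using xp x by (simp add: dist_norm s_def)
    have "\<phi> x0 \<le> \<phi> p" using e(2)[OF p(1)] px0 by simp
    also have "\<phi> p \<le> \<phi> x + L * norm (x - p)"
      using lip(3)[of x p] x px0 lip(2) e(1) by (simp add: dist_commute s_def dist_norm[of x x0, symmetric])
    also have "L * norm (x - p) \<le> L * (\<kappa> * infdist (U x) C)"
      using \<kappa>(3)[of x] x p(2) lip(1) by (simp add: s_def dist_norm)
    also have "\<dots> \<le> L * (\<kappa> * norm (U x - y))"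
      using infdist_le[OF y, of "U x"] lip(1) \<kappa>(1) by (simp add: dist_norm)
    finally show ?thesis by simp
  qed
  moreover have "s > 0" "L * \<kappa> > 0" using e(1) lip \<kappa> by (auto simp: s_def)
  ultimately show ?thesis by blast
qed

text \<open>The positive shift keeps the radicand away from 0, so the function is differentiable
  even where \<open>g\<close> vanishes.\<close>

lemma has_derivative_smoothed_norm:
  fixes g :: "'a::real_normed_vector \<Rightarrow> 'b::real_inner"
  assumes g: "(g has_derivative g') (at x)" and e: "\<epsilon> > 0"
  shows "((\<lambda>z. sqrt (g z \<bullet> g z + \<epsilon>\<^sup>2)) has_derivative
    (\<lambda>h. ((1 / sqrt (g x \<bullet> g x + \<epsilon>\<^sup>2)) *\<^sub>R g x) \<bullet> g' h)) (at x)"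
proof -
  have pos: "g x \<bullet> g x + \<epsilon>\<^sup>2 > 0" using e by (simp add: add_nonneg_pos)
  have 1: "((\<lambda>z. g z \<bullet> g z + \<epsilon>\<^sup>2) has_derivative (\<lambda>h. 2 * (g x \<bullet> g' h))) (at x)"
    by (rule has_derivative_eq_rhs, (rule derivative_intros g)+) (auto simp: inner_commute fun_eq_iff)
  have "(sqrt has_derivative (*) (inverse (sqrt (g x \<bullet> g x + \<epsilon>\<^sup>2)) / 2)) (at (g x \<bullet> g x + \<epsilon>\<^sup>2))"
    using DERIV_real_sqrt[OF pos] by (simp add: has_field_derivative_def)
  from has_derivative_compose[OF 1 this] show ?thesis
    by (rule has_derivative_eq_rhs) (simp add: fun_eq_iff inverse_eq_divide)
qed

text \<open>The smoothed penalty plus the two squared distances is minimised over a compact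
  neighbourhood. The squared distances push the minimiser into the interior of both balls, so it is
  stationary in \<open>x\<close> and satisfies Fermat's rule over \<open>C\<close> in
  \<open>y\<close>.\<close>

lemma approximate_multiplier:
  fixes U :: "'x::euclidean_space \<Rightarrow> 'w::euclidean_space" and \<phi> :: "'x \<Rightarrow> real"
  assumes C: "closed C" "U x0 \<in> C"
    and dU: "\<And>x. (U has_derivative U' x) (at x)" and d\<phi>: "\<And>x. (\<phi> has_derivative \<phi>' x) (at x)"
    and pen: "M > 0" "s > 0" "\<And>x y. norm (x - x0) < s \<Longrightarrow> y \<in> C \<Longrightarrow> \<phi> x0 \<le> \<phi> x + M * norm (U x - y)"
    and e: "e > 0"
  shows "\<exists>x y u. y \<in> C \<and> norm (x - x0) < e \<and> norm (y - U x0) < e \<and> norm u \<le> 1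
    \<and> M *\<^sub>R u - 2 *\<^sub>R (y - U x0) \<in> regular_normal C y
    \<and> (\<forall>h. \<phi>' x h + M * (u \<bullet> U' x h) + 2 * ((x - x0) \<bullet> h) = 0)"
proof -
  define \<eta> where "\<eta> = min e s / 2"
  have \<eta>: "\<eta> > 0" "\<eta> < e" "\<eta> < s" using e pen(2) by (auto simp: \<eta>_def)
  \<comment> \<open>At \<open>(x0, U x0)\<close> the smoothing costs \<open>M * \<epsilon>\<close>,
    which is half of \<open>\<eta>\<^sup>2\<close>. Comparison with the exact penalty bounds both
    squared distances by this amount.\<close>
  define \<epsilon> where "\<epsilon> = \<eta>\<^sup>2 / (2 * M)"
  have \<epsilon>: "\<epsilon> > 0" "M * \<epsilon> < \<eta>\<^sup>2" using \<eta> pen(1) by (auto simp: \<epsilon>_def)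
  define N where "N x y = sqrt ((U x - y) \<bullet> (U x - y) + \<epsilon>\<^sup>2)" for x y
  have N: "norm (U x - y) \<le> N x y" for x y
    unfolding N_def norm_eq_sqrt_inner by (intro real_sqrt_le_mono) simp
  have Npos: "N x y > 0" for x y
    using \<epsilon>(1) by (simp add: N_def add_nonneg_pos)
  define F where "F x y = \<phi> x + M * N x y + (x - x0) \<bullet> (x - x0) + (y - U x0) \<bullet> (y - U x0)" for x y
  have cont: "continuous_on UNIV U" "continuous_on UNIV \<phi>"
    using dU d\<phi> by (meson continuous_at_imp_continuous_on has_derivative_continuous)+
  define S where "S = cball x0 \<eta> \<times> (C \<inter> cball (U x0) \<eta>)"
  have S: "compact S" unfolding S_def by (intro compact_Times compact_cball closed_Int_compact C)
  have S0: "S \<noteq> {}" using C \<eta> by (auto simp: S_def)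
  have "continuous_on S (\<lambda>p. F (fst p) (snd p))"
    unfolding F_def N_def
    by (intro continuous_intros continuous_on_compose2[OF cont(1)] continuous_on_compose2[OF cont(2)]) auto
  from continuous_attains_inf[OF S S0 this]
  obtain p where p: "p \<in> S" "\<And>q. q \<in> S \<Longrightarrow> F (fst p) (snd p) \<le> F (fst q) (snd q)"
    by blast
  obtain x y where xy: "p = (x, y)" by force
  have y: "y \<in> C" and xin: "norm (x - x0) \<le> \<eta>" and yin: "norm (y - U x0) \<le> \<eta>"
    using p(1) by (auto simp: S_def xy dist_norm norm_minus_commute)
  have min: "F x y \<le> F x' y'" if "norm (x' - x0) \<le> \<eta>" "y' \<in> C" "norm (y' - U x0) \<le> \<eta>" for x' y'
    using p(2)[of "(x', y')"] that by (simp add: S_def xy dist_norm norm_minus_commute)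
  have "F x y \<le> \<phi> x0 + M * \<epsilon>"
    using min[of x0 "U x0"] C \<eta> \<epsilon>(1) by (simp add: F_def N_def)
  moreover have "\<phi> x0 \<le> \<phi> x + M * norm (U x - y)"
    using pen(3) xin \<eta> y by simp
  moreover have "M * norm (U x - y) \<le> M * N x y" using N pen(1) by simp
  ultimately have small: "(norm (x - x0))\<^sup>2 + (norm (y - U x0))\<^sup>2 < \<eta>\<^sup>2"
    using \<epsilon>(2) by (simp add: F_def power2_norm_eq_inner)
  have x\<eta>: "norm (x - x0) < \<eta>" and y\<eta>: "norm (y - U x0) < \<eta>"
    by (rule power2_less_imp_less; use small \<eta>(1) zero_le_power2[of "norm (x - x0)"] zero_le_power2[of "norm (y - U x0)"] in linarith)+
  define u where "u = (1 / N x y) *\<^sub>R (U x - y)"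
  have u: "norm u \<le> 1" using N[of x y] Npos[of x y] by (simp add: u_def divide_le_eq)
  have dNx: "((\<lambda>z. N z y) has_derivative (\<lambda>h. u \<bullet> U' x h)) (at x)"
    unfolding N_def u_def
    by (rule has_derivative_smoothed_norm[OF _ \<epsilon>(1)]) (auto intro!: derivative_eq_intros dU)
  have dNy: "((\<lambda>z. N x z) has_derivative (\<lambda>h. u \<bullet> (- h))) (at y)"
    unfolding N_def u_def
    by (rule has_derivative_smoothed_norm[OF _ \<epsilon>(1)]) (auto intro!: derivative_eq_intros)
  have "((\<lambda>z. F z y) has_derivative (\<lambda>h. \<phi>' x h + M * (u \<bullet> U' x h) + 2 * ((x - x0) \<bullet> h))) (at x)"
    unfolding F_def by (rule has_derivative_eq_rhs, (rule derivative_intros d\<phi> dNx)+)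
      (auto simp: inner_commute fun_eq_iff)
  moreover have "\<forall>z\<in>ball x0 \<eta>. F x y \<le> F z y"
    using min y yin by (auto simp: dist_norm norm_minus_commute)
  ultimately have "(\<lambda>h. \<phi>' x h + M * (u \<bullet> U' x h) + 2 * ((x - x0) \<bullet> h)) = (\<lambda>h. 0)"
    using x\<eta> by (intro differential_zero_maxmin[of x "ball x0 \<eta>" "\<lambda>z. F z y"]) (auto simp: dist_norm norm_minus_commute)
  then have stat: "\<forall>h. \<phi>' x h + M * (u \<bullet> U' x h) + 2 * ((x - x0) \<bullet> h) = 0" by metis
  have "((\<lambda>z. F x z) has_derivative (\<lambda>h. (- (M *\<^sub>R u - 2 *\<^sub>R (y - U x0))) \<bullet> h)) (at y)"
    unfolding F_def by (rule has_derivative_eq_rhs, (rule derivative_intros dNy)+)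
      (auto simp: inner_commute fun_eq_iff inner_diff_left inner_diff_right algebra_simps)
  moreover have "F x y \<le> F x z" if "z \<in> C" "norm (z - y) < \<eta> - norm (y - U x0)" for z
    using min[of x z] that xin norm_triangle_ineq[of "z - y" "y - U x0"] by simp
  ultimately have "- (- (M *\<^sub>R u - 2 *\<^sub>R (y - U x0))) \<in> regular_normal C y"
    using y\<eta> by (intro regular_normal_of_local_min[of "F x" _ y "\<eta> - norm (y - U x0)"]) auto
  then have "M *\<^sub>R u - 2 *\<^sub>R (y - U x0) \<in> regular_normal C y" by simp
  then show ?thesis using y x\<eta> y\<eta> \<eta> u stat by (intro exI[of _ x] exI[of _ y] exI[of _ u]) auto
qed

text \<open>The vectors \<open>u\<close> have norm at most 1, so a subsequence converges while the
  squared-distance terms vanish. Twice differentiability makes \<open>\<phi>'\<close> and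
  \<open>U'\<close> continuous in the base point, so stationarity passes to the limit.\<close>

lemma limiting_multiplier_exists:
  fixes U :: "'x::euclidean_space \<Rightarrow> 'w::euclidean_space" and \<phi> :: "'x \<Rightarrow> real"
  assumes C: "closed C" 
    and dU: "\<And>x. (U has_derivative U' x) (at x)"
    and d2U: "\<And>x u. ((\<lambda>y. U' y u) has_derivative U'' x u) (at x)"
    and d\<phi>: "\<And>x. (\<phi> has_derivative \<phi>' x) (at x)"
    and d2\<phi>: "\<And>x u. ((\<lambda>y. \<phi>' y u) has_derivative \<phi>'' x u) (at x)"
    and locmin: "local_minimizer \<phi> {x. U x \<in> C} x0"
    and sub: "metrically_subregular U C x0"
  shows "\<exists>m\<in>limiting_normal C (U x0). \<forall>h. \<phi>' x0 h + m \<bullet> U' x0 h = 0"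
proof -
  have x0: "U x0 \<in> C" using locmin by (simp add: local_minimizer_def)
  have cont: "continuous_on UNIV U"
    using dU by (meson continuous_at_imp_continuous_on has_derivative_continuous)
  obtain L r where lip: "L > 0" "r > 0" "\<And>x y. x \<in> ball x0 r \<Longrightarrow> y \<in> ball x0 r \<Longrightarrow> \<bar>\<phi> x - \<phi> y\<bar> \<le> L * norm (x - y)"
    using locally_lipschitz_of_twice_differentiable[OF d\<phi> d2\<phi>] by meson
  obtain M s where pen: "M > 0" "s > 0" "\<And>x y. norm (x - x0) < s \<Longrightarrow> y \<in> C \<Longrightarrow> \<phi> x0 \<le> \<phi> x + M * norm (U x - y)"
    using exact_penalty[OF C cont lip locmin sub] by meson
  have "\<exists>x y u. y \<in> C \<and> norm (x - x0) < inverse (Suc k) \<and> norm (y - U x0) < inverse (Suc k) \<and> norm u \<le> 1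
    \<and> M *\<^sub>R u - 2 *\<^sub>R (y - U x0) \<in> regular_normal C y
    \<and> (\<forall>h. \<phi>' x h + M * (u \<bullet> U' x h) + 2 * ((x - x0) \<bullet> h) = 0)" for k :: nat
    by (rule approximate_multiplier[OF C x0 dU d\<phi> pen]) auto
  then obtain x y u where xyu: "\<And>k. y k \<in> C" "\<And>k::nat. norm (x k - x0) < inverse (Suc k)"
    "\<And>k::nat. norm (y k - U x0) < inverse (Suc k)" "\<And>k. norm (u k) \<le> 1"
    "\<And>k. M *\<^sub>R u k - 2 *\<^sub>R (y k - U x0) \<in> regular_normal C (y k)"
    "\<And>k h. \<phi>' (x k) h + M * (u k \<bullet> U' (x k) h) + 2 * ((x k - x0) \<bullet> h) = 0"
    by metis
  have lim: "z \<longlonglongrightarrow> z0" if z: "\<And>k::nat. norm (z k - z0) < inverse (Suc k)" for z and z0 :: "'c::real_normed_vector"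
  proof (rule LIM_zero_cancel, rule Lim_null_comparison)
    show "eventually (\<lambda>k. norm (z k - z0) \<le> inverse (real (Suc k))) sequentially"
      using z by (simp add: less_imp_le)
  qed (rule LIMSEQ_inverse_real_of_nat)
  have "seq_compact (cball (0::'w) 1)" using compact_cball compact_eq_seq_compact_metric by blast
  then obtain l \<sigma> where l: "strict_mono \<sigma>" "(u \<circ> \<sigma>) \<longlonglongrightarrow> l"
    using xyu(4) by (metis mem_cball_0 seq_compactE)
  have x: "(\<lambda>k. x (\<sigma> k)) \<longlonglongrightarrow> x0" and y: "(\<lambda>k. y (\<sigma> k)) \<longlonglongrightarrow> U x0"
    using LIMSEQ_subseq_LIMSEQ[OF lim l(1)] xyu(2,3) unfolding o_def by blast+
  have u: "(\<lambda>k. u (\<sigma> k)) \<longlonglongrightarrow> l" using l(2) by (simp add: o_def)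
  have "(\<lambda>k. M *\<^sub>R u (\<sigma> k) - 2 *\<^sub>R (y (\<sigma> k) - U x0)) \<longlonglongrightarrow> M *\<^sub>R l - 2 *\<^sub>R (U x0 - U x0)"
    by (intro tendsto_intros u y)
  then have "M *\<^sub>R l \<in> limiting_normal C (U x0)"
    unfolding limiting_normal_def using xyu(1,5) y
    by (intro CollectI exI[of _ "\<lambda>k. y (\<sigma> k)"] exI[of _ "\<lambda>k. M *\<^sub>R u (\<sigma> k) - 2 *\<^sub>R (y (\<sigma> k) - U x0)"]) auto
  moreover have "\<phi>' x0 h + M *\<^sub>R l \<bullet> U' x0 h = 0" for h
  proof -
    have 1: "(\<lambda>k. \<phi>' (x (\<sigma> k)) h) \<longlonglongrightarrow> \<phi>' x0 h"
      using has_derivative_continuous[OF d2\<phi>] x by (rule isCont_tendsto_compose)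
    have 2: "(\<lambda>k. U' (x (\<sigma> k)) h) \<longlonglongrightarrow> U' x0 h"
      using has_derivative_continuous[OF d2U] x by (rule isCont_tendsto_compose)
    have "(\<lambda>k. \<phi>' (x (\<sigma> k)) h + M * (u (\<sigma> k) \<bullet> U' (x (\<sigma> k)) h) + 2 * ((x (\<sigma> k) - x0) \<bullet> h))
      \<longlonglongrightarrow> \<phi>' x0 h + M * (l \<bullet> U' x0 h) + 2 * ((x0 - x0) \<bullet> h)"
      by (intro tendsto_intros 1 2 u x)
    then have "(\<lambda>k. 0 :: real) \<longlonglongrightarrow> \<phi>' x0 h + M * (l \<bullet> U' x0 h)" using xyu(6) by simp
    then show ?thesis using LIMSEQ_unique[OF tendsto_const] by fastforce
  qed
  ultimately show ?thesis by blast
qed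

section \<open>Compatibility with a linear map that fixes the constraint set\<close>

lemma closed_linear_fixed_points:
  fixes P :: "'w::euclidean_space \<Rightarrow> 'w"
  assumes "linear P" shows "closed {w. P w = w}"
  using assms by (intro closed_Collect_eq linear_continuous_on) (auto simp: linear_linear)

text \<open>Difference quotients of fixed points are fixed by linearity, and the fixed-point space
  is closed.\<close>

lemma bouligand_tangent_fixed:
  fixes P :: "'w::euclidean_space \<Rightarrow> 'w"
  assumes P: "linear P" and C: "\<And>w. w \<in> C \<Longrightarrow> P w = w" and y: "y \<in> C" and v: "v \<in> bouligand_tangent C y"
  shows "P v = v"
proof -
  obtain t w where tw: "\<And>k. t k > 0" "w \<longlonglongrightarrow> v" "\<And>k. y + t k *\<^sub>R w k \<in> C"
    using v unfolding bouligand_tangent_def by blast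
  have "P (w k) = w k" for k
  proof -
    have "P (y + t k *\<^sub>R w k) = y + t k *\<^sub>R w k" by (rule C[OF tw(3)])
    then have "t k *\<^sub>R P (w k) = t k *\<^sub>R w k"
      using C[OF y] by (simp add: linear_add[OF P] linear_scale[OF P])
    then show ?thesis using tw(1)[of k] by simp
  qed
  then have "w k \<in> {w. P w = w}" for k by simp
  from closed_sequentially[OF closed_linear_fixed_points[OF P] this tw(2)] show ?thesis by simp
qed

lemma clarke_tangent_subset_bouligand_tangent:
  assumes "y \<in> C" shows "clarke_tangent C y \<subseteq> bouligand_tangent C y"
proof
  fix v assume v: "v \<in> clarke_tangent C y"
  have "\<exists>w. w \<longlonglongrightarrow> v \<and> (\<forall>k. y + inverse (real (Suc k)) *\<^sub>R w k \<in> C)"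
    using v[unfolded clarke_tangent_def, THEN CollectD, rule_format, of "\<lambda>k. inverse (real (Suc k))" "\<lambda>_. y"]
      assms LIMSEQ_inverse_real_of_nat by simp
  then obtain w where w: "w \<longlonglongrightarrow> v" "\<And>k. y + inverse (real (Suc k)) *\<^sub>R w k \<in> C" by blast
  then show "v \<in> bouligand_tangent C y"
    unfolding bouligand_tangent_def using LIMSEQ_inverse_real_of_nat
    by (intro CollectI exI[of _ "\<lambda>k. inverse (real (Suc k))"] exI[of _ w]) auto
qed

lemma outer_so_tangent_fixed:
  fixes P :: "'w::euclidean_space \<Rightarrow> 'w"
  assumes P: "linear P" and C: "\<And>w. w \<in> C \<Longrightarrow> P w = w" "closed C" and y: "y \<in> C"
    and v: "P v = v" and w: "w \<in> outer_so_tangent C y v"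
  shows "P w = w"
proof -
  have C0: "C \<noteq> {}" using y by auto
  obtain t u where t: "\<And>k. t k > 0" and u: "u \<longlonglongrightarrow> w"
      and uC: "\<And>k. y + t k *\<^sub>R v + ((t k)\<^sup>2 / 2) *\<^sub>R u k \<in> C"
    using w unfolding outer_so_tangent_iff[OF C(2) C0] by blast
  have "P (u k) = u k" for k
  proof -
    have "P (y + t k *\<^sub>R v + ((t k)\<^sup>2 / 2) *\<^sub>R u k) = y + t k *\<^sub>R v + ((t k)\<^sup>2 / 2) *\<^sub>R u k"
      by (rule C(1)[OF uC])
    then have "((t k)\<^sup>2 / 2) *\<^sub>R P (u k) = ((t k)\<^sup>2 / 2) *\<^sub>R u k"
      unfolding linear_add[OF P] linear_scale[OF P] C(1)[OF y] v by simp
    then show ?thesis using t[of k] by simp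
  qed
  then have "u k \<in> {w. P w = w}" for k by simp
  from closed_sequentially[OF closed_linear_fixed_points[OF P] this u] show ?thesis by simp
qed

text \<open>Tangents to \<open>C\<close> are fixed by \<open>P\<close>, so self-adjointness leaves
  the inner products of regular normals with them unchanged. This allows a multiplier to be
  symmetrised inside the normal cone.\<close>

lemma limiting_normal_projection:
  fixes P :: "'w::euclidean_space \<Rightarrow> 'w"
  assumes P: "linear P" "\<And>a b. P a \<bullet> b = a \<bullet> P b" and C: "\<And>w. w \<in> C \<Longrightarrow> P w = w"
    and n: "n \<in> limiting_normal C y"
  shows "P n \<in> limiting_normal C y"
proof -
  obtain yk vk where yv: "\<And>k. yk k \<in> C" "yk \<longlonglongrightarrow> y" "vk \<longlonglongrightarrow> n" "\<And>k. vk k \<in> regular_normal C (yk k)"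
    using n unfolding limiting_normal_def by blast
  have "P (vk k) \<in> regular_normal C (yk k)" for k
    using yv(4)[of k] bouligand_tangent_fixed[OF P(1) C yv(1)[of k]]
    by (simp add: regular_normal_def P(2))
  moreover have "(\<lambda>k. P (vk k)) \<longlonglongrightarrow> P n"
    using linear_linear[THEN iffD2, OF P(1)] yv(3) by (rule bounded_linear.tendsto)
  ultimately show ?thesis
    unfolding limiting_normal_def using yv(1,2)
    by (intro CollectI exI[of _ yk] exI[of _ "\<lambda>k. P (vk k)"]) auto
qed

lemma has_derivative_fixed:
  fixes P :: "'w::euclidean_space \<Rightarrow> 'w"
  assumes P: "linear P" and f: "\<And>x. P (f x) = f x" and d: "(f has_derivative f') (at x)"
  shows "P (f' h) = f' h"
proof -
  have "((\<lambda>x. P (f x)) has_derivative (\<lambda>h. P (f' h))) (at x)"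
    using linear_linear[THEN iffD2, OF P] d by (rule bounded_linear.has_derivative)
  then have "(f has_derivative (\<lambda>h. P (f' h))) (at x)" by (simp add: f)
  from has_derivative_unique[OF d this] show ?thesis by metis
qed

text \<open>Duality is applied to \<open>T\<close> plus the Clarke tangent cone rather than to
  \<open>T\<close>, since boundedness of \<open>m\<close> on this sum makes \<open>m\<close> polar
  to the cone. Replacing \<open>m\<close> by \<open>P m\<close> preserves all relevant inner
  products, because the derivatives of \<open>U\<close>, the elements of \<open>T\<close> and the
  Clarke tangents are fixed by \<open>P\<close>.\<close>

lemma second_order_clarke_multiplier_exists:
  fixes U :: "'x::euclidean_space \<Rightarrow> 'w::euclidean_space" and \<phi> :: "'x \<Rightarrow> real"
    and P :: "'w \<Rightarrow> 'w"
  assumes C: "closed C" "\<And>w. w \<in> C \<Longrightarrow> P w = w"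
    and P: "linear P" "\<And>a b. P a \<bullet> b = a \<bullet> P b" and U: "\<And>x. P (U x) = U x"
    and dU: "\<And>x. (U has_derivative U' x) (at x)"
    and d2U: "\<And>x u. ((\<lambda>y. U' y u) has_derivative U'' x u) (at x)"
    and d\<phi>: "\<And>x. (\<phi> has_derivative \<phi>' x) (at x)"
    and d2\<phi>: "\<And>x u. ((\<lambda>y. \<phi>' y u) has_derivative \<phi>'' x u) (at x)"
    and locmin: "local_minimizer \<phi> {x. U x \<in> C} x0"
    and sub: "metrically_subregular U C x0"
    and d: "d \<in> critical_cone \<phi>' U U' C x0"
    and T: "T \<noteq> {}" "convex T" "T \<subseteq> outer_so_tangent C (U x0) (U' x0 d)"
    and ri: "U' x0 w0 + U'' x0 d d \<in> rel_interior {a + b | a b. a \<in> T \<and> b \<in> clarke_tangent C (U x0)}"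
  shows "\<exists>m. P m \<in> clarke_normal C (U x0) \<and> (\<forall>h. \<phi>' x0 h + P m \<bullet> U' x0 h = 0)
    \<and> (\<forall>\<tau>\<in>T. P m \<bullet> \<tau> \<le> \<phi>'' x0 d d + P m \<bullet> U'' x0 d d)"
proof -
  have x0: "U x0 \<in> C" using locmin by (simp add: local_minimizer_def)
  have Ud: "U' x0 d \<in> bouligand_tangent C (U x0)" and "\<phi>' x0 d \<le> 0"
    using d by (auto simp: critical_cone_def)
  moreover have "0 \<le> \<phi>' x0 d"
    by (rule critical_direction_derivative_nonneg[OF C(1) dU d\<phi> locmin sub Ud])
  ultimately have \<phi>d: "\<phi>' x0 d = 0" by simp
  define T' where "T' = {a + b | a b. a \<in> T \<and> b \<in> clarke_tangent C (U x0)}"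
  have T': "a + b \<in> T'" if "a \<in> T" "b \<in> clarke_tangent C (U x0)" for a b
    using that by (auto simp: T'_def)
  have T'_so: "T' \<subseteq> outer_so_tangent C (U x0) (U' x0 d)"
    using outer_so_tangent_add_clarke_tangent[OF C(1) _ _ x0] T(3) by (auto simp: T'_def)
  have "T' = (\<Union>a\<in>T. \<Union>b\<in>clarke_tangent C (U x0). {a + b})" by (auto simp: T'_def)
  then have "convex T'" by (simp only: convex_sums[OF T(2) convex_clarke_tangent])
  then obtain m where m: "\<And>w. \<phi>' x0 w + m \<bullet> U' x0 w = 0"
    "\<And>\<tau>. \<tau> \<in> T' \<Longrightarrow> m \<bullet> \<tau> \<le> m \<bullet> U'' x0 d d + \<phi>'' x0 d d"
    using affine_convex_duality[OF has_derivative_linear[OF dU] has_derivative_linear[OF d\<phi>], of T' x0 "U'' x0 d d" x0 "\<phi>'' x0 d d" w0]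
      primal_second_order_condition[OF C(1) dU d2U d\<phi> d2\<phi> locmin sub \<phi>d] T'_so ri
    unfolding T'_def[symmetric] by blast
  have PU': "P (U' x h) = U' x h" for x h
    by (rule has_derivative_fixed[OF P(1) U dU])
  have PU'': "P (U'' x u v) = U'' x u v" for x u v
    by (rule has_derivative_fixed[OF P(1) PU' d2U])
  have PT: "P \<tau> = \<tau>" if "\<tau> \<in> T" for \<tau>
    using outer_so_tangent_fixed[OF P(1) C(2,1) x0 PU'] T(3) that by blast
  have m_polar: "m \<bullet> v \<le> 0" if v: "v \<in> clarke_tangent C (U x0)" for v
  proof (rule ccontr)
    assume "\<not> m \<bullet> v \<le> 0"
    then have mv: "m \<bullet> v > 0" by simp
    obtain a where a: "a \<in> T" using T(1) by blast
    \<comment> \<open>\<open>B\<close> is the room left above \<open>m \<bullet> a\<close>; the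
      multiple \<open>s\<close> of \<open>v\<close> overshoots it by at least 1.\<close>
    define B where "B = m \<bullet> U'' x0 d d + \<phi>'' x0 d d - m \<bullet> a"
    define s where "s = (\<bar>B\<bar> + 1) / (m \<bullet> v)"
    have s: "s > 0" "s * (m \<bullet> v) = \<bar>B\<bar> + 1" using mv by (auto simp: s_def)
    have "m \<bullet> (a + s *\<^sub>R v) \<le> m \<bullet> U'' x0 d d + \<phi>'' x0 d d"
      by (intro m(2) T' a clarke_tangent_scaleR v s)
    then show False using s(2) by (simp add: inner_add_right B_def)
  qed
  have "P m \<bullet> v \<le> 0" if v: "v \<in> clarke_tangent C (U x0)" for v
    using m_polar[OF v] bouligand_tangent_fixed[OF P(1) C(2) x0, of v]
      clarke_tangent_subset_bouligand_tangent[OF x0] v P(2)[of m v] by auto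
  then have "P m \<in> clarke_normal C (U x0)"
    by (intro clarke_tangent_polar_subset_clarke_normal C(1) x0)
  moreover have "\<phi>' x0 h + P m \<bullet> U' x0 h = 0" for h
    using m(1)[of h] by (simp add: P(2) PU')
  moreover have "P m \<bullet> \<tau> \<le> \<phi>'' x0 d d + P m \<bullet> U'' x0 d d" if "\<tau> \<in> T" for \<tau>
    \<comment> \<open>The zero Clarke tangent embeds \<open>T\<close> in \<open>T'\<close>.\<close>
    using m(2)[OF T'[OF that zero_in_clarke_tangent]] PT[OF that] by (simp add: P(2) PU'')
  ultimately show ?thesis by blast
qed

section \<open>Symmetric matrices\<close>

text \<open>The orthogonal projection onto the symmetric matrices for the trace inner
  product.\<close>

definition sym_part :: "real^'n^'n \<Rightarrow> real^'n^'n" where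
  "sym_part A = (1 / 2) *\<^sub>R (A + transpose A)"

lemma transpose_add: "transpose (A + B) = transpose A + transpose (B :: 'a::plus^'n^'m)"
  by (simp add: transpose_def vec_eq_iff)

lemma inner_transpose: "transpose A \<bullet> B = A \<bullet> transpose (B :: real^'n^'m)"
  unfolding inner_vec_def transpose_def by (simp, rule sum.swap)

lemma linear_sym_part: "linear sym_part"
  by (rule linearI) (simp_all add: sym_part_def transpose_add transpose_scalar scaleR_add_right algebra_simps)

lemma sym_part_inner: "sym_part A \<bullet> B = A \<bullet> sym_part B"
  by (simp add: sym_part_def inner_add_left inner_add_right inner_transpose)

lemma sym_mat_sym_part: "sym_mat (sym_part A)"
  by (simp add: sym_mat_def sym_part_def transpose_add transpose_scalar add.commute)

lemma sym_part_of_sym_mat: "sym_mat A \<Longrightarrow> sym_part A = A"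
  by (simp add: sym_mat_def sym_part_def flip: scaleR_2)

definition sym_proj :: "'y::real_inner \<times> (real^'n^'n) \<times> (real^'n^'n) \<Rightarrow> 'y \<times> (real^'n^'n) \<times> (real^'n^'n)" where
  "sym_proj = (\<lambda>(y, A, B). (y, sym_part A, sym_part B))"

lemma linear_sym_proj: "linear sym_proj"
  by (rule linearI) (auto simp: sym_proj_def linear_add[OF linear_sym_part] linear_scale[OF linear_sym_part])

lemma sym_proj_inner: "sym_proj a \<bullet> b = a \<bullet> sym_proj b"
  by (cases a; cases b) (simp add: sym_proj_def sym_part_inner)

section \<open>Closedness of the complementarity set\<close>

lemma closed_sym_mat: "closed {A :: real^'n^'n. sym_mat A}"
  unfolding sym_mat_def transpose_def vec_eq_iff
  by (simp, intro closed_Collect_all closed_Collect_eq continuous_intros)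

lemma continuous_on_quadratic_form: "continuous_on UNIV (\<lambda>A :: real^'n^'n. v \<bullet> (A *v v))"
  unfolding inner_vec_def matrix_vector_mult_def by (simp, intro continuous_intros)

lemma closed_psd_mat: "closed {A :: real^'n^'n. psd_mat A}"
  unfolding psd_mat_def
  by (intro closed_Collect_conj closed_sym_mat closed_Collect_all closed_Collect_le continuous_on_quadratic_form continuous_intros)

lemma closed_nsd_mat: "closed {A :: real^'n^'n. nsd_mat A}"
  unfolding nsd_mat_def
  by (intro closed_Collect_conj closed_sym_mat closed_Collect_all closed_Collect_le continuous_on_quadratic_form continuous_intros)

lemma closed_Omega: "closed (Omega :: ((real^'n^'n) \<times> (real^'n^'n)) set)"
proof -
  have "closed {p :: (real^'n^'n) \<times> (real^'n^'n). trace (transpose (fst p) ** snd p) = 0}"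
    unfolding trace_def transpose_def matrix_matrix_mult_def
    by (simp, intro closed_Collect_eq continuous_intros)
  then have "closed (({A. psd_mat A} \<times> {B. nsd_mat B})
    \<inter> {p :: (real^'n^'n) \<times> (real^'n^'n). trace (transpose (fst p) ** snd p) = 0})"
    by (intro closed_Int closed_Times closed_psd_mat closed_nsd_mat)
  moreover have "\<dots> = Omega" by (auto simp: Omega_def)
  ultimately show ?thesis by simp
qed

section \<open>Specialisation to \<open>K \<times> Omega\<close>\<close>

theorem theorem5p1:
  fixes \<phi> :: "'x::euclidean_space \<Rightarrow> real"
    and \<phi>' :: "'x \<Rightarrow> 'x \<Rightarrow> real" and \<phi>'' :: "'x \<Rightarrow> 'x \<Rightarrow> 'x \<Rightarrow> real"
    and h :: "'x \<Rightarrow> 'y::euclidean_space"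
    and h' :: "'x \<Rightarrow> 'x \<Rightarrow> 'y" and h'' :: "'x \<Rightarrow> 'x \<Rightarrow> 'x \<Rightarrow> 'y"
    and \<theta> \<zeta> :: "'x \<Rightarrow> real^'n::finite^'n"
    and \<theta>' \<zeta>' :: "'x \<Rightarrow> 'x \<Rightarrow> real^'n^'n"
    and \<theta>'' \<zeta>'' :: "'x \<Rightarrow> 'x \<Rightarrow> 'x \<Rightarrow> real^'n^'n"
    and K :: "'y set" and xs :: 'x
  assumes d\<phi>: "\<And>x. (\<phi> has_derivative \<phi>' x) (at x)"
    and d2\<phi>: "\<And>x u. ((\<lambda>y. \<phi>' y u) has_derivative \<phi>'' x u) (at x)"
    and dh: "\<And>x. (h has_derivative h' x) (at x)"
    and d2h: "\<And>x u. ((\<lambda>y. h' y u) has_derivative h'' x u) (at x)"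
    and d\<theta>: "\<And>x. (\<theta> has_derivative \<theta>' x) (at x)"
    and d2\<theta>: "\<And>x u. ((\<lambda>y. \<theta>' y u) has_derivative \<theta>'' x u) (at x)"
    and d\<zeta>: "\<And>x. (\<zeta> has_derivative \<zeta>' x) (at x)"
    and d2\<zeta>: "\<And>x u. ((\<lambda>y. \<zeta>' y u) has_derivative \<zeta>'' x u) (at x)"
    and sym\<theta>: "\<And>x. sym_mat (\<theta> x)" and sym\<zeta>: "\<And>x. sym_mat (\<zeta> x)"
    and K: "closed K" "convex K" "cone K" "second_order_regular K"
    and locmin: "local_minimizer \<phi> (feasible_set (Ups h \<theta> \<zeta>) (K \<times> Omega)) xs"
    and subreg: "metrically_subregular (Ups h \<theta> \<zeta>) (K \<times> Omega) xs"
  shows "multipliers limiting_normal \<phi>' (Ups h \<theta> \<zeta>) (DUps h' \<theta>' \<zeta>') (K \<times> Omega) xs \<noteq> {}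
    \<and> (\<forall>d Td. d \<in> critical_cone \<phi>' (Ups h \<theta> \<zeta>) (DUps h' \<theta>' \<zeta>') (K \<times> Omega) xs
        \<and> Td \<noteq> {} \<and> convex Td
        \<and> Td \<subseteq> outer_so_tangent (K \<times> Omega) (Ups h \<theta> \<zeta> xs) (DUps h' \<theta>' \<zeta>' xs d)
        \<and> rel_interior {a + b | a b. a \<in> Td \<and> b \<in> clarke_tangent (K \<times> Omega) (Ups h \<theta> \<zeta> xs)}
          \<inter> {DUps h' \<theta>' \<zeta>' xs u + D2Ups h'' \<theta>'' \<zeta>'' xs d d | u. True} \<noteq> {}
      \<longrightarrow> (SUP m \<in> multipliers clarke_normal \<phi>' (Ups h \<theta> \<zeta>) (DUps h' \<theta>' \<zeta>') (K \<times> Omega) xs.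
            ereal (\<phi>'' xs d d + m \<bullet> D2Ups h'' \<theta>'' \<zeta>'' xs d d) - support_fun m Td) \<ge> 0)"
proof -
  let ?U = "Ups h \<theta> \<zeta>" and ?U' = "DUps h' \<theta>' \<zeta>'" and ?U'' = "D2Ups h'' \<theta>'' \<zeta>''"
  let ?C = "K \<times> (Omega :: ((real^'n^'n) \<times> (real^'n^'n)) set)"
  let ?P = "sym_proj :: 'y \<times> (real^'n^'n) \<times> (real^'n^'n) \<Rightarrow> _"
  have dU: "(?U has_derivative ?U' x) (at x)" for x
    unfolding Ups_def[abs_def] DUps_def[abs_def] by (intro has_derivative_Pair dh d\<theta> d\<zeta>)
  have d2U: "((\<lambda>y. ?U' y u) has_derivative ?U'' x u) (at x)" for x u
    unfolding DUps_def[abs_def] D2Ups_def[abs_def] by (intro has_derivative_Pair d2h d2\<theta> d2\<zeta>)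
  have C: "closed ?C" by (intro closed_Times K(1) closed_Omega)
  have PC: "?P w = w" if "w \<in> ?C" for w
    using that by (auto simp: sym_proj_def Omega_def psd_mat_def nsd_mat_def sym_part_of_sym_mat)
  have PU: "?P (?U x) = ?U x" for x
    by (simp add: sym_proj_def Ups_def sym_part_of_sym_mat sym\<theta> sym\<zeta>)
  have lm: "local_minimizer \<phi> {x. ?U x \<in> ?C} xs"
    using locmin by (simp add: feasible_set_def)
  have PU': "?P (?U' x v) = ?U' x v" for x v
    by (rule has_derivative_fixed[OF linear_sym_proj PU dU])
  \<comment> \<open>Stated for an arbitrary normal cone operator \<open>N\<close>, to serve both the
    limiting and the Clarke multipliers; the projection supplies the symmetry that
    \<open>multipliers\<close> demands.\<close>
  have multI: "?P m \<in> multipliers N \<phi>' ?U ?U' ?C xs"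
    if "?P m \<in> N ?C (?U xs)" "\<And>v. \<phi>' xs v + ?P m \<bullet> ?U' xs v = 0" for m N
    using that unfolding multipliers_def sym_proj_def by (cases m) (simp add: sym_mat_sym_part)
  obtain n where n: "n \<in> limiting_normal ?C (?U xs)" "\<And>v. \<phi>' xs v + n \<bullet> ?U' xs v = 0"
    using limiting_multiplier_exists[OF C dU d2U d\<phi> d2\<phi> lm subreg] by blast
  have "?P n \<in> multipliers limiting_normal \<phi>' ?U ?U' ?C xs"
  proof (rule multI[of n limiting_normal])
    show "?P n \<in> limiting_normal ?C (?U xs)"
      by (rule limiting_normal_projection[OF linear_sym_proj sym_proj_inner PC n(1)])
    show "\<phi>' xs v + ?P n \<bullet> ?U' xs v = 0" for v
      using n(2)[of v] by (simp add: sym_proj_inner PU')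
  qed
  moreover have "(SUP m \<in> multipliers clarke_normal \<phi>' ?U ?U' ?C xs.
      ereal (\<phi>'' xs d d + m \<bullet> ?U'' xs d d) - support_fun m Td) \<ge> 0"
    if d: "d \<in> critical_cone \<phi>' ?U ?U' ?C xs" and T: "Td \<noteq> {}" "convex Td"
      "Td \<subseteq> outer_so_tangent ?C (?U xs) (?U' xs d)"
      and ri: "?U' xs u + ?U'' xs d d \<in> rel_interior {a + b | a b. a \<in> Td \<and> b \<in> clarke_tangent ?C (?U xs)}"
    for d Td u
  proof -
    obtain m where m: "?P m \<in> clarke_normal ?C (?U xs)" "\<And>v. \<phi>' xs v + ?P m \<bullet> ?U' xs v = 0"
      "\<And>\<tau>. \<tau> \<in> Td \<Longrightarrow> ?P m \<bullet> \<tau> \<le> \<phi>'' xs d d + ?P m \<bullet> ?U'' xs d d"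
      using second_order_clarke_multiplier_exists[OF C PC linear_sym_proj sym_proj_inner PU dU d2U d\<phi> d2\<phi> lm subreg d T ri]
      by blast
    \<comment> \<open>The pointwise bound over \<open>Td\<close> has a real right-hand side, so the
      extended-real difference is nonnegative at this one multiplier, and the supremum dominates
      it.\<close>
    have "support_fun (?P m) Td \<le> ereal (\<phi>'' xs d d + ?P m \<bullet> ?U'' xs d d)"
      unfolding support_fun_def by (rule SUP_least) (use m(3) in simp)
    then have "0 \<le> ereal (\<phi>'' xs d d + ?P m \<bullet> ?U'' xs d d) - support_fun (?P m) Td"
      by (simp add: ereal_diff_positive)
    also have "\<dots> \<le> (SUP m \<in> multipliers clarke_normal \<phi>' ?U ?U' ?C xs.
      ereal (\<phi>'' xs d d + m \<bullet> ?U'' xs d d) - support_fun m Td)"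
      by (rule SUP_upper[OF multI[of m clarke_normal, OF m(1,2)]])
    finally show ?thesis .
  qed
  ultimately show ?thesis by (intro conjI allI impI) (blast, elim conjE, blast)
qed

end
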